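(* Let $X$ be a finitely generated conformal iterated function system, generated by $\varphi_1,\ldots,\varphi_m$, acting on $\overline{\mathbb{B}^2}$. If $X$ satisfies the strong disk open set condition, then there exists a uniformly quasiregular map $f:\mathbb{C}\to\mathbb{C}$ with $J(f)$ equal to the attractor set $S$ of $X$.
   Context: $\mathbb{B}^2$ is the open unit disk in $\mathbb{R}^2=\mathbb{C}$. IFS: a finitely generated iterated function system (IFS) $X$ acting on a closed set $D\subset\mathbb{R}^n$ is a finite collection of contractions $\varphi_1,\ldots,\varphi_m$, $\varphi_i:D\to D$, i.e. for each $i$ there is $s_i\in(0,1)$ with $|\varphi_i(x)-\varphi_i(y)|\le s_i|x-y|$ for all $x,y\in D$. Its attractor set is the unique non-empty compact set $S\subset D$ with $S=\bigcup_{i=1}^m\varphi_i(S)$. The IFS is conformal if the $\varphi_i$ are conformal mappings (here: injective and holomorphic on the open disk $\mathbb{B}^2$). Strong disk open set condition: $X$ generated by $\varphi_1,\ldots,\varphi_m$ acting on $\overline{\mathbb{B}^2}$ satisfies the strong disk open set condition if (i) $\overline{\varphi_i(\mathbb{B}^2)}\subset\mathbb{B}^2$ for $i=1,\ldots,m$, and (ii) $\overline{\varphi_i(\mathbb{B}^2)}\cap\overline{\varphi_j(\mathbb{B}^2)}=\emptyset$ for $i\ne j$. Quasiregular maps: a continuous map $f:\mathbb{R}^n\to\mathbb{R}^n$ ($n\ge2$) is quasiregular if $f\in ACL^n$ (equivalently $f\in W^{1,n}_{loc}$) and there is $K\ge1$ with $|f'(x)|^n\le KJ_f(x)$ almost everywhere;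 the smallest such $K$ is $K_O(f)$, and $K_I(f)$ is the smallest $K'$ with $J_f(x)\le K'\inf_{|h|=1}|f'(x)h|^n$ almost everywhere. The maximal distortion is $K(f)=\max\{K_O(f),K_I(f)\}$. The map $f$ is uniformly quasiregular (uqr) if there is a uniform bound on the maximal distortion of all iterates $f^k$, $k\in\mathbb{N}$. Julia set: $z\in J(f)$ if and only if there is no neighbourhood $U$ of $z$ such that the family of iterates $\{f^k|_U:k\in\mathbb{N}\}$ is normal. Normality is understood with respect to the spherical metric on $\overline{\mathbb{C}}$ (the limit $\infty$ being allowed). *)

theory Defs
  imports "HOL-Analysis.Analysis"
begin

section \<open>Iterated function systems\<close>

definition ifs :: "'a::euclidean_space set \<Rightarrow> nat \<Rightarrow> (nat \<Rightarrow> 'a \<Rightarrow> 'a) \<Rightarrow> bool" where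
  "ifs D m \<phi> \<longleftrightarrow> closed D \<and> 1 \<le> m \<and>
     (\<forall>i\<in>{1..m}. \<phi> i ` D \<subseteq> D \<and> (\<exists>s\<in>{0<..<1}. s-lipschitz_on D (\<phi> i)))"

text \<open>Existence and uniqueness of the described set for an IFS is Hutchinson's theorem.\<close>

definition attractor :: "'a::euclidean_space set \<Rightarrow> nat \<Rightarrow> (nat \<Rightarrow> 'a \<Rightarrow> 'a) \<Rightarrow> 'a set" where
  "attractor D m \<phi> =
     (THE S. S \<noteq> {} \<and> compact S \<and> S \<subseteq> D \<and> S = (\<Union>i\<in>{1..m}. \<phi> i ` S))"

text \<open>The maps live on the closed disk; conformality only concerns the open disk.\<close>

definition conformal_disk_ifs :: "nat \<Rightarrow> (nat \<Rightarrow> complex \<Rightarrow> complex) \<Rightarrow> bool" where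
  "conformal_disk_ifs m \<phi> \<longleftrightarrow> ifs (cball 0 1) m \<phi> \<and>
     (\<forall>i\<in>{1..m}. \<phi> i holomorphic_on ball 0 1 \<and> inj_on (\<phi> i) (ball 0 1))"

definition strong_disk_open_set_condition :: "nat \<Rightarrow> (nat \<Rightarrow> complex \<Rightarrow> complex) \<Rightarrow> bool" where
  "strong_disk_open_set_condition m \<phi> \<longleftrightarrow>
     (\<forall>i\<in>{1..m}. closure (\<phi> i ` ball 0 1) \<subseteq> ball 0 1) \<and>
     (\<forall>i\<in>{1..m}. \<forall>j\<in>{1..m}. i \<noteq> j \<longrightarrow>
        closure (\<phi> i ` ball 0 1) \<inter> closure (\<phi> j ` ball 0 1) = {})"


section \<open>Quasiregular maps of the plane\<close>

text \<open>Absolute continuity of a function on an interval; \<open>P\<close> is a finite family of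
  non-overlapping subintervals, given by their pairs of endpoints.\<close>

definition abs_continuous_on_interval :: "real \<Rightarrow> real \<Rightarrow> (real \<Rightarrow> 'a::metric_space) \<Rightarrow> bool" where
  "abs_continuous_on_interval a b g \<longleftrightarrow>
     (\<forall>\<epsilon>>0. \<exists>\<delta>>0. \<forall>P. finite P \<and>
        (\<forall>(u, v)\<in>P. a \<le> u \<and> u \<le> v \<and> v \<le> b) \<and>
        pairwise (\<lambda>p q. disjnt {fst p<..<snd p} {fst q<..<snd q}) P \<and>
        (\<Sum>(u, v)\<in>P. v - u) < \<delta> \<longrightarrow>
        (\<Sum>(u, v)\<in>P. dist (g u) (g v)) < \<epsilon>)"

text \<open>ACL: absolutely continuous on almost every segment parallel to a coordinate axis in
  every closed rectangle.\<close>

definition ACL :: "(complex \<Rightarrow> complex) \<Rightarrow> bool" where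
  "ACL f \<longleftrightarrow> (\<forall>a b.
     (AE y in lborel. y \<in> {Im a..Im b} \<longrightarrow>
        abs_continuous_on_interval (Re a) (Re b) (\<lambda>x. f (Complex x y))) \<and>
     (AE x in lborel. x \<in> {Re a..Re b} \<longrightarrow>
        abs_continuous_on_interval (Im a) (Im b) (\<lambda>y. f (Complex x y))))"

text \<open>The partial derivatives of an ACL map exist almost everywhere; elsewhere the values below
  are arbitrary.\<close>

definition partial_x :: "(complex \<Rightarrow> complex) \<Rightarrow> complex \<Rightarrow> complex" where
  "partial_x f z = vector_derivative (\<lambda>x. f (Complex x (Im z))) (at (Re z))"

definition partial_y :: "(complex \<Rightarrow> complex) \<Rightarrow> complex \<Rightarrow> complex" where
  "partial_y f z = vector_derivative (\<lambda>y. f (Complex (Re z) y)) (at (Im z))"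

definition ACL2 :: "(complex \<Rightarrow> complex) \<Rightarrow> bool" where
  "ACL2 f \<longleftrightarrow> ACL f \<and>
     (\<forall>C. compact C \<longrightarrow>
        set_integrable lebesgue C (\<lambda>z. (norm (partial_x f z))\<^sup>2) \<and>
        set_integrable lebesgue C (\<lambda>z. (norm (partial_y f z))\<^sup>2))"

text \<open>The formal derivative, i.e. the linear map whose matrix consists of the partial
  derivatives, and the determinant of that matrix.\<close>

definition formal_deriv :: "(complex \<Rightarrow> complex) \<Rightarrow> complex \<Rightarrow> complex \<Rightarrow> complex" where
  "formal_deriv f z h = Re h *\<^sub>R partial_x f z + Im h *\<^sub>R partial_y f z"

definition jacobian :: "(complex \<Rightarrow> complex) \<Rightarrow> complex \<Rightarrow> real" where
  "jacobian f z = Re (partial_x f z) * Im (partial_y f z) - Im (partial_x f z) * Re (partial_y f z)"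

definition outer_distortion_bound :: "(complex \<Rightarrow> complex) \<Rightarrow> real \<Rightarrow> bool" where
  "outer_distortion_bound f K \<longleftrightarrow> 1 \<le> K \<and>
     (AE z in lebesgue. (onorm (formal_deriv f z))\<^sup>2 \<le> K * jacobian f z)"

definition inner_distortion_bound :: "(complex \<Rightarrow> complex) \<Rightarrow> real \<Rightarrow> bool" where
  "inner_distortion_bound f K \<longleftrightarrow> 1 \<le> K \<and>
     (AE z in lebesgue. jacobian f z \<le> K * (INF h\<in>sphere 0 1. (norm (formal_deriv f z h))\<^sup>2))"

definition quasiregular :: "(complex \<Rightarrow> complex) \<Rightarrow> bool" where
  "quasiregular f \<longleftrightarrow> continuous_on UNIV f \<and> ACL2 f \<and> (\<exists>K. outer_distortion_bound f K)"

text \<open>Extended reals make the infimum \<open>\<infinity>\<close> when there is no bound.  For constant maps every real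
  number satisfies the two inequalities; the requirement \<open>1 \<le> K\<close> then gives distortion 1.\<close>

definition K_outer :: "(complex \<Rightarrow> complex) \<Rightarrow> ereal" where
  "K_outer f = Inf {ereal K |K. outer_distortion_bound f K}"

definition K_inner :: "(complex \<Rightarrow> complex) \<Rightarrow> ereal" where
  "K_inner f = Inf {ereal K |K. inner_distortion_bound f K}"

definition maximal_distortion :: "(complex \<Rightarrow> complex) \<Rightarrow> ereal" where
  "maximal_distortion f = max (K_outer f) (K_inner f)"

definition uniformly_quasiregular :: "(complex \<Rightarrow> complex) \<Rightarrow> bool" where
  "uniformly_quasiregular f \<longleftrightarrow>
     (\<forall>k. quasiregular (f ^^ k)) \<and>
     (\<exists>C::real. \<forall>k. maximal_distortion (f ^^ k) \<le> ereal C)"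


section \<open>Normal families and the Julia set\<close>

text \<open>Stereographic projection to the unit sphere of \<open>complex \<times> real\<close>; the point at infinity
  corresponds to \<open>(0, 1)\<close>.  The distance of the images is the chordal form
  \<open>2 \<bar>z - w\<bar> / (sqrt (1 + \<bar>z\<bar>\<^sup>2) * sqrt (1 + \<bar>w\<bar>\<^sup>2))\<close> of the spherical metric.\<close>

definition stereo :: "complex \<Rightarrow> complex \<times> real" where
  "stereo z = ((2 / (1 + (norm z)\<^sup>2)) *\<^sub>R z, ((norm z)\<^sup>2 - 1) / ((norm z)\<^sup>2 + 1))"

text \<open>The limit \<open>g\<close> is a map into the Riemann sphere, realised as the unit sphere, and may thus
  take the value infinity.\<close>

definition normal_family_on :: "complex set \<Rightarrow> (complex \<Rightarrow> complex) set \<Rightarrow> bool" where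
  "normal_family_on U F \<longleftrightarrow>
     (\<forall>h :: nat \<Rightarrow> complex \<Rightarrow> complex. range h \<subseteq> F \<longrightarrow>
        (\<exists>r g. strict_mono r \<and> g \<in> U \<rightarrow> sphere 0 1 \<and>
          (\<forall>C. compact C \<and> C \<subseteq> U \<longrightarrow>
             uniform_limit C (\<lambda>n z. stereo (h (r n) z)) g sequentially)))"

definition julia_set :: "(complex \<Rightarrow> complex) \<Rightarrow> complex set" where
  "julia_set f = {z. \<not> (\<exists>U. open U \<and> z \<in> U \<and> normal_family_on U (range (\<lambda>k. f ^^ k)))}"

end

theory Submission
  imports Defs "HOL-Complex_Analysis.Complex_Analysis"
begin

text \<open>The attractor is realised as the set of non-escaping points of a map \<open>F\<close> that inverts the
contractions.  Fix \<open>r < 1\<close> such that all \<open>\<phi>\<^sub>i\<close> map the closed unit disk into the disk of radius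
\<open>r\<close>.  Suppose that \<open>F\<close> is the inverse of \<open>\<phi>\<^sub>i\<close> on the image of the disk of radius \<open>r\<close>, is
holomorphic and expanding outside the disk of radius \<open>r\<close>, and sends every point at which it is not
conformal to that outside region.  Then each orbit passes at most once through the non-conformal
region, so every iterate has at most the dilatation of \<open>F\<close> (\<open>iterate_qc\<close>).  A point either
escapes to infinity at a geometric rate, and the iterates are normal near it, or it is trapped in
the disk of radius \<open>r\<close>; the trapped points form the attractor (\<open>attractor_eq_trapped\<close>).  Near a trapped
point the iterates are not normal, because the contractions bring preimages of a point that is not trapped
arbitrarily close to it (\<open>trapped_subset_julia\<close>).

The construction of \<open>F\<close> is \<open>expanding_extension\<close>.  Outside the images of the unit disk, \<open>F\<close> is
a large multiple \<open>N P\<close> of the polynomial \<open>P\<close> with simple roots \<open>\<phi>\<^sub>i 0\<close>.  In the coordinate of the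
\<open>i\<close>-th disk, \<open>N P\<close> becomes \<open>N z exp (q\<^sub>i z)\<close>, and \<open>F\<close> has to join this to the identity across
an annulus with positive Jacobian.  This is \<open>disc_interpolation\<close>: a radial stretch first moves the
critical points of \<open>N P\<close> out of the way, and then the exponent is switched off by a cut-off
function; a large \<open>N\<close> makes the exponent nearly a positive constant, so that this amounts to
little more than a radial expansion.

All cut-offs are once continuously differentiable.  Hence so are \<open>F\<close> and its iterates, and the
analytic side of quasiregularity reduces to a pointwise comparison of Wirtinger derivatives
(\<open>quasiregular_C1\<close>).\<close>

section \<open>Wirtinger derivatives and pointwise dilatation\<close>

text \<open>The real-linear maps of the plane are exactly \<open>h \<mapsto> a h + b cnj h\<close>.  If this is the
derivative of \<open>f\<close>, then \<open>a\<close> and \<open>b\<close> are its Wirtinger derivatives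
\<open>\<partial>f\<close> and \<open>\<partial>f/\<partial>(cnj z)\<close>; conformality means \<open>b = 0\<close>, and the
Jacobian is \<open>\<bar>a\<bar>\<^sup>2 - \<bar>b\<bar>\<^sup>2\<close>.\<close>

definition wirtinger :: "(complex \<Rightarrow> complex) \<Rightarrow> complex \<Rightarrow> complex \<Rightarrow> complex \<Rightarrow> bool" where
  "wirtinger f a b z \<longleftrightarrow> (f has_derivative (\<lambda>h. a * h + b * cnj h)) (at z)"

text \<open>The dilatation at a point, in a form that tolerates critical points: both derivatives may
vanish.  The case \<open>k = 0\<close> is complex differentiability.\<close>

definition qc_at :: "real \<Rightarrow> (complex \<Rightarrow> complex) \<Rightarrow> complex \<Rightarrow> bool" where
  "qc_at k f z \<longleftrightarrow> (\<exists>a b. wirtinger f a b z \<and> norm b \<le> k * norm a)"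

definition C1_on :: "complex set \<Rightarrow> (complex \<Rightarrow> complex) \<Rightarrow> bool" where
  "C1_on U f \<longleftrightarrow> (\<exists>a b. continuous_on U a \<and> continuous_on U b \<and> (\<forall>z\<in>U. wirtinger f (a z) (b z) z))"

lemma wirtinger_compose:
  assumes "wirtinger f a b z" "wirtinger g c d (f z)"
  shows "wirtinger (g \<circ> f) (c * a + d * cnj b) (c * b + d * cnj a) z"
proof -
  have "(g \<circ> f has_derivative (\<lambda>h. c * h + d * cnj h) \<circ> (\<lambda>h. a * h + b * cnj h)) (at z)"
    using assms unfolding wirtinger_def by (intro diff_chain_at)
  moreover have "(\<lambda>h. c * h + d * cnj h) \<circ> (\<lambda>h. a * h + b * cnj h)
      = (\<lambda>h. (c * a + d * cnj b) * h + (c * b + d * cnj a) * cnj h)"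
    by (auto simp: algebra_simps)
  ultimately show ?thesis unfolding wirtinger_def by simp
qed

lemma wirtinger_of_field_derivative:
  "(f has_field_derivative a) (at z) \<Longrightarrow> wirtinger f a 0 z"
  by (simp add: wirtinger_def has_field_derivative_def)

lemma wirtinger_cong_open:
  assumes "wirtinger f a b z" "open U" "z \<in> U" "\<And>w. w \<in> U \<Longrightarrow> g w = f w"
  shows "wirtinger g a b z"
  using assms(1) unfolding wirtinger_def
  by (rule has_derivative_transform_within_open[OF _ assms(2,3)]) (simp add: assms(4))

lemma wirtinger_mult:
  assumes "wirtinger f a b z" "wirtinger g c d z"
  shows "wirtinger (\<lambda>z. f z * g z) (f z * c + a * g z) (f z * d + b * g z) z"
proof -
  have "((\<lambda>z. f z * g z) has_derivative
      (\<lambda>h. f z * (c * h + d * cnj h) + (a * h + b * cnj h) * g z)) (at z)"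
    using assms unfolding wirtinger_def by (rule has_derivative_mult)
  then show ?thesis unfolding wirtinger_def by (simp add: algebra_simps)
qed

text \<open>Here \<open>\<bar>z\<bar>\<^sup>2 = z cnj z\<close>, so its Wirtinger derivatives are \<open>cnj z\<close> and \<open>z\<close>.\<close>

lemma wirtinger_radial:
  assumes "(\<beta> has_real_derivative \<beta>') (at ((norm z)\<^sup>2))"
  shows "wirtinger (\<lambda>z. of_real (\<beta> ((norm z)\<^sup>2))) (of_real \<beta>' * cnj z) (of_real \<beta>' * z) z"
proof -
  have "((\<lambda>z. \<beta> (z \<bullet> z)) has_derivative (\<lambda>h. (z \<bullet> h + h \<bullet> z) * \<beta>')) (at z)"
    using assms unfolding power2_norm_eq_inner by (auto intro!: derivative_eq_intros DERIV_compose_FDERIV[of \<beta> \<beta>' "\<lambda>z. z \<bullet> z"])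
  then have "((\<lambda>z. complex_of_real (\<beta> ((norm z)\<^sup>2))) has_derivative
      (\<lambda>h. of_real ((z \<bullet> h + h \<bullet> z) * \<beta>'))) (at z)"
    unfolding power2_norm_eq_inner by (rule has_derivative_of_real)
  moreover have "complex_of_real ((z \<bullet> h + h \<bullet> z) * \<beta>') = of_real \<beta>' * cnj z * h + of_real \<beta>' * z * cnj h" for h
    by (simp add: complex_eq_iff inner_complex_def algebra_simps)
  ultimately show ?thesis unfolding wirtinger_def by (simp only:)
qed

lemma wirtinger_partials:
  assumes "wirtinger f a b z"
  shows "partial_x f z = a + b" "partial_y f z = \<i> * (a - b)"
    "((\<lambda>x. f (Complex x (Im z))) has_vector_derivative (a + b)) (at (Re z))"
    "((\<lambda>y. f (Complex (Re z) y)) has_vector_derivative (\<i> * (a - b))) (at (Im z))"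
proof -
  have D: "(f has_derivative (\<lambda>h. a * h + b * cnj h)) (at z)"
    using assms by (simp add: wirtinger_def)
  have x: "((\<lambda>x. Complex x (Im z)) has_derivative (\<lambda>t. of_real t)) (at (Re z))"
    by (simp add: complex_eq_iff Complex_eq) (auto intro!: derivative_eq_intros)
  have y: "((\<lambda>y. Complex (Re z) y) has_derivative (\<lambda>t. \<i> * of_real t)) (at (Im z))"
    by (simp add: Complex_eq) (auto intro!: derivative_eq_intros)
  show 1: "((\<lambda>x. f (Complex x (Im z))) has_vector_derivative (a + b)) (at (Re z))"
    using diff_chain_at[OF x, of f "\<lambda>h. a * h + b * cnj h"] D
    by (simp add: has_vector_derivative_def o_def scaleR_conv_of_real algebra_simps)
  show 2: "((\<lambda>y. f (Complex (Re z) y)) has_vector_derivative (\<i> * (a - b))) (at (Im z))"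
    using diff_chain_at[OF y, of f "\<lambda>h. a * h + b * cnj h"] D
    by (simp add: has_vector_derivative_def o_def scaleR_conv_of_real algebra_simps)
  show "partial_x f z = a + b" "partial_y f z = \<i> * (a - b)"
    unfolding partial_x_def partial_y_def using 1 2 by (auto intro: vector_derivative_at)
qed

lemma wirtinger_formal_deriv:
  assumes "wirtinger f a b z"
  shows "formal_deriv f z = (\<lambda>h. a * h + b * cnj h)" "jacobian f z = (norm a)\<^sup>2 - (norm b)\<^sup>2"
proof -
  note p = wirtinger_partials(1,2)[OF assms]
  show "formal_deriv f z = (\<lambda>h. a * h + b * cnj h)"
    by (auto simp: formal_deriv_def p complex_eq_iff algebra_simps)
  show "jacobian f z = (norm a)\<^sup>2 - (norm b)\<^sup>2"
    unfolding jacobian_def p cmod_power2 by (simp add: power2_eq_square algebra_simps)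
qed

text \<open>Both Wirtinger derivatives can be recovered from the partial derivatives.  Unlike the
existentially bound functions \<open>a\<close> and \<open>b\<close>, the partial derivatives are determined by \<open>f\<close>,
so in this form being \<open>C\<^sup>1\<close> is visibly a local property.\<close>

lemma C1_on_via_partials:
  "C1_on U f \<longleftrightarrow> continuous_on U (partial_x f) \<and> continuous_on U (partial_y f) \<and>
     (\<forall>z\<in>U. \<exists>a b. wirtinger f a b z)" (is "?L = ?R")
proof
  assume ?L
  then obtain a b where c: "continuous_on U a" "continuous_on U b"
    and w: "\<And>z. z \<in> U \<Longrightarrow> wirtinger f (a z) (b z) z"
    unfolding C1_on_def by auto
  have "continuous_on U (\<lambda>z. a z + b z)" "continuous_on U (\<lambda>z. \<i> * (a z - b z))"
    using c by (auto intro!: continuous_intros)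
  then have "continuous_on U (partial_x f)" "continuous_on U (partial_y f)"
    using wirtinger_partials(1,2)[OF w] by (simp_all cong: continuous_on_cong)
  moreover have "\<forall>z\<in>U. \<exists>a b. wirtinger f a b z" by (intro ballI exI) (rule w)
  ultimately show ?R by (intro conjI)
next
  assume R: ?R
  define a where "a z = (partial_x f z - \<i> * partial_y f z) / 2" for z
  define b where "b z = (partial_x f z + \<i> * partial_y f z) / 2" for z
  have "wirtinger f (a z) (b z) z" if "z \<in> U" for z
  proof -
    have "\<exists>c d. wirtinger f c d z" using R that by simp
    then obtain c d where w: "wirtinger f c d z" by (elim exE)
    have "a z = c" "b z = d"
      unfolding a_def b_def wirtinger_partials(1,2)[OF w] by (simp_all add: algebra_simps)
    then show ?thesis using w by simp
  qed
  moreover have "continuous_on U a" "continuous_on U b"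
    unfolding a_def b_def using R by (auto intro!: continuous_intros)
  ultimately show ?L unfolding C1_on_def by blast
qed

lemma C1_on_Union:
  assumes "\<And>U. U \<in> \<U> \<Longrightarrow> open U" "\<And>U. U \<in> \<U> \<Longrightarrow> C1_on U f"
  shows "C1_on (\<Union>\<U>) f"
  using assms unfolding C1_on_via_partials
  by (auto intro!: continuous_on_open_Union)

lemma C1_on_subset: "C1_on U f \<Longrightarrow> V \<subseteq> U \<Longrightarrow> C1_on V f"
  unfolding C1_on_def by (meson continuous_on_subset subsetD)

lemma C1_on_cong_open:
  assumes "C1_on U f" "open U" "\<And>w. w \<in> U \<Longrightarrow> g w = f w"
  shows "C1_on U g"
proof -
  obtain a b where ab: "continuous_on U a" "continuous_on U b"
    and w: "\<And>z. z \<in> U \<Longrightarrow> wirtinger f (a z) (b z) z"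
    using assms(1) unfolding C1_on_def by blast
  show ?thesis unfolding C1_on_def
    by (intro exI[of _ a] exI[of _ b] conjI ballI ab wirtinger_cong_open[OF w assms(2)] assms(3))
qed

lemma C1_on_imp_continuous_on:
  assumes "C1_on U f" shows "continuous_on U f"
  using assms unfolding C1_on_def wirtinger_def
  by (meson continuous_at_imp_continuous_on has_derivative_continuous)

lemma C1_on_holomorphic:
  assumes "f holomorphic_on U" "open U" shows "C1_on U f"
proof -
  have "continuous_on U (deriv f)"
    using assms by (simp add: holomorphic_deriv holomorphic_on_imp_continuous_on)
  moreover have "\<forall>z\<in>U. wirtinger f (deriv f z) 0 z"
    using assms by (auto intro: wirtinger_of_field_derivative holomorphic_derivI)
  ultimately show ?thesis unfolding C1_on_def by (intro exI[of _ "deriv f"] exI[of _ "\<lambda>_. 0"]) auto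
qed

lemma C1_on_compose:
  assumes "C1_on U f" "C1_on V g" "f ` U \<subseteq> V"
  shows "C1_on U (g \<circ> f)"
proof -
  obtain a b where ab: "continuous_on U a" "continuous_on U b"
    and w: "\<And>z. z \<in> U \<Longrightarrow> wirtinger f (a z) (b z) z"
    using assms unfolding C1_on_def by blast
  obtain c d where cd: "continuous_on V c" "continuous_on V d"
    and w': "\<And>z. z \<in> V \<Longrightarrow> wirtinger g (c z) (d z) z"
    using assms unfolding C1_on_def by blast
  have f: "continuous_on U f" using assms C1_on_imp_continuous_on by blast
  have cf: "continuous_on U (\<lambda>z. c (f z))" "continuous_on U (\<lambda>z. d (f z))"
    using continuous_on_compose2[OF cd(1) f] continuous_on_compose2[OF cd(2) f] assms(3) by auto
  show ?thesis unfolding C1_on_def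
  proof (intro exI conjI ballI)
    fix z assume "z \<in> U"
    then show "wirtinger (g \<circ> f) (c (f z) * a z + d (f z) * cnj (b z))
        (c (f z) * b z + d (f z) * cnj (a z)) z"
      using assms(3) w w' by (intro wirtinger_compose) auto
  qed (use ab cf in \<open>auto intro!: continuous_intros\<close>)
qed

lemma C1_on_funpow:
  assumes "C1_on UNIV f" shows "C1_on UNIV (f ^^ n)"
proof (induction n)
  case 0
  show ?case using C1_on_holomorphic[of id UNIV] by (simp add: id_def)
next
  case (Suc n)
  then show ?case using C1_on_compose[OF Suc assms] by (simp add: o_def)
qed

lemma qc_at_field_derivative: "(f has_field_derivative a) (at z) \<Longrightarrow> qc_at 0 f z"
  unfolding qc_at_def by (intro exI conjI, erule wirtinger_of_field_derivative) simp

lemma qc_at_holomorphic: "f holomorphic_on U \<Longrightarrow> open U \<Longrightarrow> z \<in> U \<Longrightarrow> qc_at 0 f z"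
  by (meson holomorphic_derivI qc_at_field_derivative)

lemma qc_at_mono: "qc_at k f z \<Longrightarrow> k \<le> l \<Longrightarrow> qc_at l f z"
  unfolding qc_at_def by (meson mult_right_mono norm_ge_zero order_trans)

lemma qc_at_cong_open:
  assumes "qc_at k f z" "open U" "z \<in> U" "\<And>w. w \<in> U \<Longrightarrow> g w = f w"
  shows "qc_at k g z"
  using assms(1) wirtinger_cong_open[OF _ assms(2,3,4)] unfolding qc_at_def by (elim exE conjE) (intro exI conjI)

text \<open>Multiplying \<open>a h + b cnj h\<close> by a complex number, or substituting \<open>c h\<close> for \<open>h\<close>,
scales \<open>\<bar>a\<bar>\<close> and \<open>\<bar>b\<bar>\<close> by the same factor.  Conformal maps therefore
preserve the dilatation on either side; this is what keeps the distortion of all iterates bounded.\<close>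

lemma qc_at_conformal_compose:
  assumes "qc_at k f z" "qc_at 0 g (f z)"
  shows "qc_at k (g \<circ> f) z"
proof -
  obtain a b where ab: "wirtinger f a b z" "norm b \<le> k * norm a"
    using assms(1) unfolding qc_at_def by (elim exE conjE)
  from assms(2) obtain c where "wirtinger g c 0 (f z)" unfolding qc_at_def by auto
  from wirtinger_compose[OF ab(1) this] have "wirtinger (g \<circ> f) (c * a) (c * b) z" by simp
  moreover have "norm (c * b) \<le> k * norm (c * a)"
    using mult_left_mono[OF ab(2), of "norm c"] by (simp add: norm_mult algebra_simps)
  ultimately show ?thesis unfolding qc_at_def by blast
qed

lemma qc_at_compose_conformal:
  assumes "qc_at 0 f z" "qc_at k g (f z)"
  shows "qc_at k (g \<circ> f) z"
proof -
  obtain a b where ab: "wirtinger g a b (f z)" "norm b \<le> k * norm a"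
    using assms(2) unfolding qc_at_def by (elim exE conjE)
  from assms(1) obtain c where "wirtinger f c 0 z" unfolding qc_at_def by auto
  from wirtinger_compose[OF this ab(1)] have "wirtinger (g \<circ> f) (a * c) (b * cnj c) z" by simp
  moreover have "norm (b * cnj c) \<le> k * norm (a * c)"
    using mult_right_mono[OF ab(2), of "norm c"] by (simp add: norm_mult algebra_simps)
  ultimately show ?thesis unfolding qc_at_def by blast
qed

text \<open>The Beltrami quotient \<open>\<bar>b\<bar> / \<bar>a\<bar>\<close> is continuous and below 1, so it attains a
maximum below 1.  It thus suffices to build maps whose Jacobian is positive at every point.\<close>

lemma qc_at_uniform_on_compact:
  assumes "compact C" "continuous_on C a" "continuous_on C b"
    and "\<And>z. z \<in> C \<Longrightarrow> norm (b z) < norm (a z :: complex)"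
    and w: "\<And>z. z \<in> C \<Longrightarrow> wirtinger f (a z) (b z) z"
  shows "\<exists>k. 0 \<le> k \<and> k < 1 \<and> (\<forall>z\<in>C. qc_at k f z)"
proof (cases "C = {}")
  case True then show ?thesis by (intro exI[of _ 0]) auto
next
  case False
  have nz: "a z \<noteq> 0" if "z \<in> C" for z using assms(4)[OF that] by auto
  have "continuous_on C (\<lambda>z. norm (b z) / norm (a z))"
    using assms nz by (auto intro!: continuous_intros)
  from continuous_attains_sup[OF assms(1) False this] obtain w where
    w': "w \<in> C" "\<And>z. z \<in> C \<Longrightarrow> norm (b z) / norm (a z) \<le> norm (b w) / norm (a w)" by auto
  show ?thesis
  proof (intro exI[of _ "norm (b w) / norm (a w)"] conjI ballI)
    show "norm (b w) / norm (a w) < 1" using assms(4)[OF w'(1)] by (simp add: divide_less_eq)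
    fix z assume z: "z \<in> C"
    have "norm (b z) \<le> norm (b w) / norm (a w) * norm (a z)"
      using w'(2)[OF z] nz[OF z] by (simp add: divide_le_eq)
    then show "qc_at (norm (b w) / norm (a w)) f z"
      using w[OF z] unfolding qc_at_def by blast
  qed auto
qed

section \<open>Quasiregularity of continuously differentiable maps\<close>

lemma abs_continuous_on_interval_C1:
  assumes "continuous_on {a..b} g'"
    and "\<And>t. t \<in> {a..b} \<Longrightarrow> (g has_vector_derivative g' t) (at t)"
  shows "abs_continuous_on_interval a b (g :: real \<Rightarrow> complex)"
proof -
  obtain B where B: "\<And>t. t \<in> {a..b} \<Longrightarrow> norm (g' t) \<le> B" "B > 0"
  proof -
    have "bounded (g' ` {a..b})"
      by (intro compact_imp_bounded compact_continuous_image assms(1) compact_Icc)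
    then show ?thesis using that unfolding bounded_pos by blast
  qed
  have lip: "dist (g u) (g v) \<le> B * (v - u)" if "a \<le> u" "u \<le> v" "v \<le> b" for u v
  proof -
    have "norm (g u - g v) \<le> B * norm (u - v)"
    proof (rule differentiable_bound[of "{a..b}" g "\<lambda>t h. h *\<^sub>R g' t"])
      fix t assume t: "t \<in> {a..b}"
      show "(g has_derivative (\<lambda>h. h *\<^sub>R g' t)) (at t within {a..b})"
        using assms(2)[OF t] by (simp add: has_vector_derivative_def has_derivative_at_withinI)
      show "onorm (\<lambda>h. h *\<^sub>R g' t) \<le> B"
        using B(1)[OF t] onorm_scaleR_left[OF bounded_linear_ident, of "g' t"] by (simp add: onorm_id[unfolded id_def])
    qed (use that in auto)
    then show ?thesis using that by (simp add: dist_norm)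
  qed
  show ?thesis unfolding abs_continuous_on_interval_def
  proof (intro allI impI)
    fix e :: real assume e: "e > 0"
    show "\<exists>\<delta>>0. \<forall>P. finite P \<and>
        (\<forall>(u, v)\<in>P. a \<le> u \<and> u \<le> v \<and> v \<le> b) \<and>
        pairwise (\<lambda>p q. disjnt {fst p<..<snd p} {fst q<..<snd q}) P \<and>
        (\<Sum>(u, v)\<in>P. v - u) < \<delta> \<longrightarrow> (\<Sum>(u, v)\<in>P. dist (g u) (g v)) < e"
    proof (intro exI[of _ "e / B"] conjI allI impI)
      fix P :: "(real \<times> real) set"
      assume P: "finite P \<and> (\<forall>(u, v)\<in>P. a \<le> u \<and> u \<le> v \<and> v \<le> b) \<and>
        pairwise (\<lambda>p q. disjnt {fst p<..<snd p} {fst q<..<snd q}) P \<and> (\<Sum>(u, v)\<in>P. v - u) < e / B"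
      have "(\<Sum>(u, v)\<in>P. dist (g u) (g v)) \<le> (\<Sum>(u, v)\<in>P. B * (v - u))"
        using P lip by (intro sum_mono) auto
      also have "\<dots> = B * (\<Sum>(u, v)\<in>P. v - u)"
        by (simp add: sum_distrib_left case_prod_unfold)
      also have "\<dots> < e" using P B(2) by (simp add: field_simps)
      finally show "(\<Sum>(u, v)\<in>P. dist (g u) (g v)) < e" .
    qed (use e B in auto)
  qed
qed

lemma ACL2_C1:
  assumes "C1_on UNIV f" shows "ACL2 f"
proof -
  have c: "continuous_on UNIV (partial_x f)" "continuous_on UNIV (partial_y f)"
    and w: "\<And>z. \<exists>a b. wirtinger f a b z"
    using assms unfolding C1_on_via_partials by auto
  have vx: "((\<lambda>x. f (Complex x y)) has_vector_derivative partial_x f (Complex x y)) (at x)" for x y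
    using w[of "Complex x y"] wirtinger_partials(1,3)[of f _ _ "Complex x y"] by auto
  have vy: "((\<lambda>y. f (Complex x y)) has_vector_derivative partial_y f (Complex x y)) (at y)" for x y
    using w[of "Complex x y"] wirtinger_partials(2,4)[of f _ _ "Complex x y"] by auto
  have "abs_continuous_on_interval a b (\<lambda>x. f (Complex x y))" for a b y
    by (rule abs_continuous_on_interval_C1[OF _ vx])
      (auto simp: Complex_eq intro!: continuous_intros continuous_on_compose2[OF c(1)])
  moreover have "abs_continuous_on_interval a b (\<lambda>y. f (Complex x y))" for a b x
    by (rule abs_continuous_on_interval_C1[OF _ vy])
      (auto simp: Complex_eq intro!: continuous_intros continuous_on_compose2[OF c(2)])
  ultimately have "ACL f" unfolding ACL_def by simp
  moreover have "set_integrable lebesgue C (\<lambda>z. (norm (g z))\<^sup>2)"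
    if "compact C" "continuous_on UNIV g" for C and g :: "complex \<Rightarrow> complex"
  proof -
    have "continuous_on C (\<lambda>z. (norm (g z))\<^sup>2)"
      using that by (auto intro!: continuous_intros intro: continuous_on_subset)
    from borel_integrable_compact[OF that(1) this]
    have i: "set_integrable lborel C (\<lambda>z. (norm (g z))\<^sup>2)"
      by (simp add: set_integrable_def indicator_def if_distrib cong: if_cong)
    then show ?thesis
      unfolding set_integrable_def
      using integrable_completion[OF borel_measurable_integrable] by blast
  qed
  ultimately show ?thesis using c unfolding ACL2_def by blast
qed

text \<open>For \<open>L h = a h + b cnj h\<close> the largest and smallest stretching factors are
\<open>\<bar>a\<bar> + \<bar>b\<bar>\<close> and \<open>\<bar>a\<bar> - \<bar>b\<bar>\<close>, and the Jacobian is their product.  Both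
distortions are therefore at most their quotient, which \<open>\<bar>b\<bar> \<le> k \<bar>a\<bar>\<close> bounds by
\<open>(1 + k) / (1 - k)\<close>.\<close>

lemma quasiregular_C1:
  assumes "C1_on UNIV f" and qc: "\<And>z. qc_at k f z" and k: "0 \<le> k" "k < 1"
  shows "quasiregular f" "maximal_distortion f \<le> ereal ((1 + k) / (1 - k))"
proof -
  define K where "K = (1 + k) / (1 - k)"
  have K: "1 \<le> K" using k by (simp add: K_def field_simps)
  have Kb: "norm a + norm b \<le> K * (norm a - norm b)" if "norm b \<le> k * norm a" for a b :: complex
  proof -
    have "(norm a + norm b) * (1 - k) \<le> (1 + k) * (norm a - norm b)"
      using that by (simp add: algebra_simps)
    then show ?thesis using k by (simp add: K_def field_simps)
  qed
  have le: "norm b \<le> norm a" if "norm b \<le> k * norm a" for a b :: complex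
    using that k mult_right_mono[of k 1 "norm a"] by simp
  have "(onorm (formal_deriv f z))\<^sup>2 \<le> K * jacobian f z" for z
  proof -
    obtain a b where w: "wirtinger f a b z" and b: "norm b \<le> k * norm a"
      using qc unfolding qc_at_def by blast
    have "onorm (formal_deriv f z) \<le> norm a + norm b"
      unfolding wirtinger_formal_deriv(1)[OF w]
    proof (rule onorm_le)
      fix h show "norm (a * h + b * cnj h) \<le> (norm a + norm b) * norm h"
        by (rule order_trans[OF norm_triangle_ineq]) (simp add: norm_mult algebra_simps)
    qed
    moreover have "0 \<le> onorm (formal_deriv f z)"
    proof -
      have "bounded_linear (formal_deriv f z)"
        using w has_derivative_bounded_linear unfolding wirtinger_formal_deriv(1)[OF w] wirtinger_def by blast
      then show ?thesis by (rule onorm_pos_le)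
    qed
    ultimately have "(onorm (formal_deriv f z))\<^sup>2 \<le> (norm a + norm b)\<^sup>2" by (intro power_mono)
    also have "\<dots> = (norm a + norm b) * (norm a + norm b)" by (simp add: power2_eq_square)
    also have "\<dots> \<le> (norm a + norm b) * (K * (norm a - norm b))"
      using Kb[OF b] by (intro mult_left_mono) auto
    also have "\<dots> = K * jacobian f z"
      unfolding wirtinger_formal_deriv(2)[OF w] by (simp add: power2_eq_square algebra_simps)
    finally show ?thesis .
  qed
  then have outer: "outer_distortion_bound f K"
    unfolding outer_distortion_bound_def using K by simp
  have "jacobian f z \<le> K * (INF h\<in>sphere 0 1. (norm (formal_deriv f z h))\<^sup>2)" for z
  proof -
    obtain a b where w: "wirtinger f a b z" and b: "norm b \<le> k * norm a"
      using qc unfolding qc_at_def by blast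
    have "(norm a - norm b)\<^sup>2 \<le> (INF h\<in>sphere 0 1. (norm (formal_deriv f z h))\<^sup>2)"
    proof (rule cINF_greatest)
      fix h :: complex assume "h \<in> sphere 0 1"
      then have "norm a - norm b \<le> norm (a * h + b * cnj h)"
        using norm_triangle_ineq2[of "a * h" "- (b * cnj h)"] by (simp add: norm_mult)
      then show "(norm a - norm b)\<^sup>2 \<le> (norm (formal_deriv f z h))\<^sup>2"
        unfolding wirtinger_formal_deriv(1)[OF w] using le[OF b] by (intro power_mono) auto
    qed auto
    then have "K * (norm a - norm b)\<^sup>2 \<le> K * (INF h\<in>sphere 0 1. (norm (formal_deriv f z h))\<^sup>2)"
      using K by (intro mult_left_mono) auto
    moreover have "jacobian f z \<le> K * (norm a - norm b)\<^sup>2"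
      using mult_right_mono[OF Kb[OF b], of "norm a - norm b"] le[OF b]
      unfolding wirtinger_formal_deriv(2)[OF w] by (simp add: power2_eq_square algebra_simps)
    ultimately show ?thesis by linarith
  qed
  then have inner: "inner_distortion_bound f K"
    unfolding inner_distortion_bound_def using K by simp
  show "quasiregular f"
    unfolding quasiregular_def using ACL2_C1 assms(1) C1_on_imp_continuous_on outer by blast
  show "maximal_distortion f \<le> ereal ((1 + k) / (1 - k))"
    unfolding maximal_distortion_def K_outer_def K_inner_def K_def[symmetric]
    using outer inner by (auto intro!: Inf_lower)
qed

section \<open>Interpolation on the unit disk\<close>

lemma DERIV_square_positive_part:
  "((\<lambda>x::real. (max 0 x)\<^sup>2) has_real_derivative 2 * max 0 x) (at x)"
proof -
  consider "x < 0" | "x > 0" | "x = 0" by linarith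
  then show ?thesis
  proof cases
    case 1
    have "((\<lambda>x::real. 0) has_real_derivative 0) (at x)" by simp
    then have "((\<lambda>x::real. (max 0 x)\<^sup>2) has_real_derivative 0) (at x)"
      by (rule has_field_derivative_transform_within_open[of _ _ _ "{..<0}"]) (use 1 in auto)
    then show ?thesis using 1 by simp
  next
    case 2
    have "((\<lambda>x::real. x\<^sup>2) has_real_derivative 2 * x) (at x)" by (auto intro!: derivative_eq_intros)
    then have "((\<lambda>x::real. (max 0 x)\<^sup>2) has_real_derivative 2 * x) (at x)"
      by (rule has_field_derivative_transform_within_open[of _ _ _ "{0<..}"]) (use 2 in auto)
    then show ?thesis using 2 by simp
  next
    case 3
    have "((\<lambda>h::real. max 0 h) \<longlongrightarrow> max 0 0) (at 0)" by (intro tendsto_intros)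
    then have "((\<lambda>h::real. ((max 0 (0 + h))\<^sup>2 - (max 0 0)\<^sup>2) / h) \<longlongrightarrow> 0) (at 0)"
      by (rule Lim_transform_eventually[where f = "max 0", THEN tendsto_eq_rhs])
        (auto simp: eventually_at_filter max_def power2_eq_square)
    then show ?thesis unfolding DERIV_def 3 by simp
  qed
qed

text \<open>The quotient \<open>p (t - u) / (p (t - u) + p (v - t))\<close> with \<open>p x = (max 0 x)\<^sup>2\<close> is a
once continuously differentiable monotone cut-off function.\<close>

lemma smooth_step:
  fixes u v :: real
  assumes "u < v"
  obtains s s' where "\<And>t. (s has_real_derivative s' t) (at t)" "continuous_on UNIV s'" "\<And>t. 0 \<le> s' t"
    "\<And>t. t \<le> u \<Longrightarrow> s t = 0" "\<And>t. v \<le> t \<Longrightarrow> s t = 1" "\<And>t. 0 \<le> s t" "\<And>t. s t \<le> (1::real)"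
proof
  define p :: "real \<Rightarrow> real" where "p x = (max 0 x)\<^sup>2" for x
  define s where "s t = p (t - u) / (p (t - u) + p (v - t))" for t
  define s' where "s' t = (2 * max 0 (t - u) * p (v - t) + p (t - u) * (2 * max 0 (v - t)))
      / (p (t - u) + p (v - t))\<^sup>2" for t
  have pos: "p (t - u) + p (v - t) > 0" for t
  proof (cases "t > u")
    case True then have "p (t - u) > 0" by (simp add: p_def)
    then show ?thesis by (simp add: p_def add_pos_nonneg)
  next
    case False then have "p (v - t) > 0" using assms by (simp add: p_def)
    then show ?thesis by (simp add: p_def add_nonneg_pos)
  qed
  have dp: "(p has_real_derivative 2 * max 0 x) (at x)" for x
    unfolding p_def by (rule DERIV_square_positive_part)
  show "(s has_real_derivative s' t) (at t)" for t
  proof -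
    have "((\<lambda>t. t - u) has_real_derivative 1) (at t)" "((\<lambda>t. v - t) has_real_derivative - 1) (at t)"
      by (auto intro!: derivative_eq_intros)
    note d = DERIV_chain2[OF dp this(1)] DERIV_chain2[OF dp this(2)]
    have 1: "((\<lambda>t. p (t - u)) has_real_derivative 2 * max 0 (t - u)) (at t)" using d(1) by simp
    have 2: "((\<lambda>t. p (v - t)) has_real_derivative - (2 * max 0 (v - t))) (at t)" using d(2) by simp
    show ?thesis unfolding s_def
      by (rule DERIV_divide[OF 1 DERIV_add[OF 1 2], THEN DERIV_cong])
        (use pos[of t] in \<open>simp_all add: s'_def power2_eq_square, simp add: algebra_simps\<close>)
  qed
  have "continuous_on UNIV p" unfolding p_def by (intro continuous_intros)
  then have c: "continuous_on UNIV (\<lambda>t. p (t - u))" "continuous_on UNIV (\<lambda>t. p (v - t))"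
    by (auto intro!: continuous_on_compose2[of UNIV p] continuous_intros)
  have "p (t - u) + p (v - t) \<noteq> 0" for t using pos[of t] by simp
  then show "continuous_on UNIV s'"
    unfolding s'_def using c by (intro continuous_intros) auto
  show "0 \<le> s' t" for t by (auto simp: s'_def p_def)
  show "s t = 0" if "t \<le> u" for t using that by (simp add: s_def p_def)
  show "s t = 1" if "v \<le> t" for t using that pos[of t] by (auto simp: s_def p_def)
  show "0 \<le> s t" "s t \<le> 1" for t using pos[of t] by (auto simp: s_def p_def divide_le_eq)
qed

text \<open>The hypotheses put \<open>A\<close> in the sector of half-angle \<open>\<pi>/6\<close> and \<open>\<kappa>\<close> in that of
half-angle \<open>\<pi>/3\<close> around the positive axis, so the two vectors enclose an angle of at most
\<open>\<pi>/2\<close> and adding \<open>A\<close> can only make \<open>t \<kappa>\<close> longer.\<close>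

lemma norm_less_norm_add_sector:
  fixes A \<kappa> :: complex
  assumes "norm (A - 1) \<le> 1/2" "norm \<kappa> \<le> 2 * Re \<kappa>" "0 \<le> t"
  shows "norm (of_real t * \<kappa>) < norm (A + of_real t * \<kappa>)"
proof -
  have "\<bar>Re ((A - 1) * cnj \<kappa>)\<bar> \<le> norm (A - 1) * norm \<kappa>"
    using abs_Re_le_cmod[of "(A - 1) * cnj \<kappa>"] by (simp add: norm_mult)
  also have "\<dots> \<le> 1/2 * norm \<kappa>" using assms(1) by (intro mult_right_mono) auto
  finally have "- Re ((A - 1) * cnj \<kappa>) \<le> 1/2 * norm \<kappa>" by linarith
  moreover have "Re ((A - 1) * cnj \<kappa>) = Re (A * cnj \<kappa>) - Re \<kappa>" by (simp add: algebra_simps)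
  ultimately have 1: "0 \<le> Re (A * cnj \<kappa>)" using assms(2) by linarith
  have "norm (1 :: complex) \<le> norm A + norm (A - 1)"
    using norm_triangle_ineq4[of A "A - 1"] by simp
  then have 2: "0 < norm A" using assms(1) unfolding norm_one by linarith
  have "(norm (A + of_real t * \<kappa>))\<^sup>2 = (norm A)\<^sup>2 + (norm (of_real t * \<kappa>))\<^sup>2 + 2 * t * Re (A * cnj \<kappa>)"
    unfolding cmod_power2 by (simp add: power2_eq_square algebra_simps)
  then have "(norm (of_real t * \<kappa>))\<^sup>2 < (norm (A + of_real t * \<kappa>))\<^sup>2"
    using 1 2 assms(3) by (simp add: add_pos_nonneg)
  then show ?thesis by (rule power2_less_imp_less) simp
qed

text \<open>With \<open>A = 1 + \<beta> z \<kappa>'\<close> and \<open>B = \<beta>' \<bar>z\<bar>\<^sup>2 \<kappa>\<close>, the two derivatives have, up to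
the common factor \<open>exp (\<beta> \<kappa>)\<close>, the absolute values \<open>\<bar>A + B\<bar>\<close> and \<open>\<bar>B\<bar>\<close>.\<close>

lemma wirtinger_twist:
  assumes "(\<beta> has_real_derivative \<beta>') (at ((norm z)\<^sup>2))" "(\<kappa> has_field_derivative \<kappa>') (at z)"
  shows "wirtinger (\<lambda>z. z * exp (of_real (\<beta> ((norm z)\<^sup>2)) * \<kappa> z))
     (exp (of_real (\<beta> ((norm z)\<^sup>2)) * \<kappa> z) *
        ((1 + of_real (\<beta> ((norm z)\<^sup>2)) * (z * \<kappa>')) + of_real (\<beta>' * (norm z)\<^sup>2) * \<kappa> z))
     (exp (of_real (\<beta> ((norm z)\<^sup>2)) * \<kappa> z) * (of_real \<beta>' * z\<^sup>2 * \<kappa> z)) z"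
proof -
  let ?E = "exp (of_real (\<beta> ((norm z)\<^sup>2)) * \<kappa> z)"
  note 1 = wirtinger_mult[OF wirtinger_radial[OF assms(1)] wirtinger_of_field_derivative[OF assms(2)]]
  note 2 = wirtinger_compose[OF 1 wirtinger_of_field_derivative[OF DERIV_exp]]
  have 3: "wirtinger (\<lambda>z. z) 1 0 z" using wirtinger_of_field_derivative[OF DERIV_ident] .
  have nz: "(complex_of_real (norm z))\<^sup>2 = z * cnj z" using complex_norm_square[of z] by simp
  show ?thesis
    using wirtinger_mult[OF 3 2] by (simp add: o_def algebra_simps power2_eq_square nz[unfolded power2_eq_square])
qed

lemma wirtinger_radial_stretch:
  assumes "(l has_real_derivative d) (at ((norm z)\<^sup>2))"
  shows "wirtinger (\<lambda>z. of_real (l ((norm z)\<^sup>2)) * z)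
     (of_real (l ((norm z)\<^sup>2) + d * (norm z)\<^sup>2)) (of_real d * z\<^sup>2) z"
proof -
  have nz: "(complex_of_real (norm z))\<^sup>2 = z * cnj z" using complex_norm_square[of z] by simp
  show ?thesis
    using wirtinger_mult[OF wirtinger_radial[OF assms] wirtinger_of_field_derivative[OF DERIV_ident]]
    by (simp add: nz[unfolded power2_eq_square] power2_eq_square algebra_simps)
qed

text \<open>The goal is a map of bounded dilatation that is the identity on the disk of radius \<open>r\<close> and
equals the holomorphic map \<open>H w = N w exp (q w)\<close> near the unit circle.

\<^item> \<open>H\<close> may have critical points anywhere away from 0.  It is therefore composed with a radial
stretch \<open>\<rho>\<close> that multiplies by the small number \<open>\<epsilon>\<close> for \<open>\<bar>z\<bar> \<le> r2\<close> and is the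
identity for \<open>\<bar>z\<bar> \<ge> r3\<close>.  Composing a holomorphic map with \<open>\<rho>\<close> costs only the
dilatation of \<open>\<rho>\<close>, and on the disk of radius \<open>r2\<close> only the values of \<open>H\<close> near 0 matter.
\<^item> There \<open>H (\<epsilon> z) = z exp (\<kappa> z)\<close> with \<open>\<kappa> z = q (\<epsilon> z) + ln (N \<epsilon>)\<close>, and the
interpolation to the identity between the radii \<open>r\<close> and \<open>r1\<close> is \<open>z exp (\<beta> \<kappa> z)\<close>,
where \<open>\<beta>\<close> increases from 0 to 1.  For small \<open>\<epsilon>\<close> the function \<open>\<kappa>\<close> is almost
constant, and for large \<open>N\<close> its values lie in a sector about the positive axis; this is what the hypotheses
\<open>small\<close> and \<open>sector\<close> express, and together they make the Jacobian positive.

Neither piece decreases absolute values, the inner one because \<open>Re \<kappa> \<ge> 0\<close> and the outer one by the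
hypothesis \<open>large\<close>.\<close>

lemma disc_interpolation:
  fixes q :: "complex \<Rightarrow> complex" and r \<epsilon> N :: real
  assumes hol: "q holomorphic_on ball 0 1" and r: "0 < r" "r < 1" and eps: "0 < \<epsilon>" "\<epsilon> < 1" and N: "0 < N"
    and small: "\<And>w. norm w \<le> \<epsilon> \<Longrightarrow> norm (w * deriv q w) \<le> 1/2"
    and sector: "\<And>w. norm w \<le> \<epsilon> \<Longrightarrow> norm (q w + of_real (ln (N * \<epsilon>))) \<le> 2 * Re (q w + of_real (ln (N * \<epsilon>)))"
    and large: "\<And>w. \<epsilon> * r \<le> norm w \<Longrightarrow> norm w < 1 \<Longrightarrow> 2 \<le> N * norm (w * exp (q w))"
  obtains g R k where "0 \<le> k" "k < 1" "R < 1" "C1_on (ball 0 1) g"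
    "\<And>z. norm z \<le> r \<Longrightarrow> g z = z"
    "\<And>z. R \<le> norm z \<Longrightarrow> norm z < 1 \<Longrightarrow> g z = of_real N * (z * exp (q z))"
    "\<And>z. norm z < 1 \<Longrightarrow> qc_at k g z"
    "\<And>z. norm z < 1 \<Longrightarrow> norm z \<le> norm (g z)"
proof -
  obtain r1 where r1: "r < r1" "r1 < 1" using r dense by blast
  obtain r2 where r2: "r1 < r2" "r2 < 1" using r1 dense by blast
  obtain r3 where r3: "r2 < r3" "r3 < 1" using r2 dense by blast
  have sq: "r\<^sup>2 < r1\<^sup>2" "r2\<^sup>2 < r3\<^sup>2" using r r1 r2 r3 by (auto intro!: power_strict_mono)
  obtain \<beta> \<beta>' where \<beta>: "\<And>t. (\<beta> has_real_derivative \<beta>' t) (at t)" "continuous_on UNIV \<beta>'" "\<And>t. 0 \<le> \<beta>' t"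
    "\<And>t. t \<le> r\<^sup>2 \<Longrightarrow> \<beta> t = 0" "\<And>t. r1\<^sup>2 \<le> t \<Longrightarrow> \<beta> t = 1" "\<And>t. 0 \<le> \<beta> t" "\<And>t. \<beta> t \<le> (1::real)"
    using smooth_step[OF sq(1)] by metis
  obtain s s' where s: "\<And>t. (s has_real_derivative s' t) (at t)" "continuous_on UNIV s'" "\<And>t. 0 \<le> s' t"
    "\<And>t. t \<le> r2\<^sup>2 \<Longrightarrow> s t = 0" "\<And>t. r3\<^sup>2 \<le> t \<Longrightarrow> s t = 1" "\<And>t. 0 \<le> s t" "\<And>t. s t \<le> (1::real)"
    using smooth_step[OF sq(2)] by metis
  define l where "l t = \<epsilon> + (1 - \<epsilon>) * s t" for t
  define l' where "l' t = (1 - \<epsilon>) * s' t" for t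
  have l: "(l has_real_derivative l' t) (at t)" for t
    unfolding l_def l'_def by (auto intro!: derivative_eq_intros s(1))
  have l_bounds: "\<epsilon> \<le> l t" "l t \<le> 1" for t
  proof -
    show "\<epsilon> \<le> l t" using eps s(6)[of t] by (simp add: l_def)
    have "(1 - \<epsilon>) * s t \<le> (1 - \<epsilon>) * 1" using eps s(7)[of t] by (intro mult_left_mono) auto
    then show "l t \<le> 1" by (simp add: l_def)
  qed
  have l'_nonneg: "0 \<le> l' t" for t using eps s(3)[of t] by (simp add: l'_def)
  have cont: "continuous_on UNIV \<beta>" "continuous_on UNIV l" "continuous_on UNIV l'"
  proof -
    show "continuous_on UNIV \<beta>" "continuous_on UNIV l"
      using DERIV_isCont[OF \<beta>(1)] DERIV_isCont[OF l] by (simp_all add: continuous_at_imp_continuous_on)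
    show "continuous_on UNIV l'" unfolding l'_def by (intro continuous_intros s(2))
  qed
  have cnorm: "continuous_on V (\<lambda>z::complex. f ((norm z)\<^sup>2))" if "continuous_on UNIV f" for V and f :: "real \<Rightarrow> real"
    by (rule continuous_on_compose2[OF that]) (auto intro!: continuous_intros)

  define \<kappa> where "\<kappa> z = q (of_real \<epsilon> * z) + of_real (ln (N * \<epsilon>))" for z
  define \<kappa>' where "\<kappa>' z = of_real \<epsilon> * deriv q (of_real \<epsilon> * z)" for z
  have eps_ball: "of_real \<epsilon> * z \<in> ball 0 1" "norm (of_real \<epsilon> * z) \<le> \<epsilon>" if "norm z < 1" for z :: complex
  proof -
    have "norm (of_real \<epsilon> * z) = \<epsilon> * norm z" using eps by (simp add: norm_mult)
    moreover have "\<epsilon> * norm z \<le> \<epsilon> * 1" using that eps by (intro mult_left_mono) auto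
    ultimately show "norm (of_real \<epsilon> * z) \<le> \<epsilon>" "of_real \<epsilon> * z \<in> ball 0 1"
      using eps unfolding mem_ball dist_0_norm by linarith+
  qed
  have \<kappa>: "(\<kappa> has_field_derivative \<kappa>' z) (at z)" if "norm z < 1" for z
  proof -
    have "(q has_field_derivative deriv q (of_real \<epsilon> * z)) (at (of_real \<epsilon> * z))"
      using eps_ball(1)[OF that] hol by (intro holomorphic_derivI) auto
    from DERIV_add[OF DERIV_chain2[where g = "\<lambda>z. of_real \<epsilon> * z", OF this DERIV_cmult_Id] DERIV_const]
    show ?thesis unfolding \<kappa>_def \<kappa>'_def by (simp add: mult.commute)
  qed
  have cont\<kappa>: "continuous_on (ball 0 1) \<kappa>" "continuous_on (ball 0 1) \<kappa>'"
  proof -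
    show "continuous_on (ball 0 1) \<kappa>"
      using DERIV_isCont[OF \<kappa>] by (intro continuous_at_imp_continuous_on) simp
    have "continuous_on (ball 0 1) (deriv q)"
      by (intro holomorphic_on_imp_continuous_on holomorphic_deriv hol) auto
    then have "continuous_on (ball 0 1) (\<lambda>z. deriv q (of_real \<epsilon> * z))"
      by (rule continuous_on_compose2[where g = "deriv q"])
        (use eps_ball(1) in \<open>auto intro!: continuous_on_mult_left\<close>)
    then show "continuous_on (ball 0 1) \<kappa>'" unfolding \<kappa>'_def by (rule continuous_on_mult_left)
  qed
  have \<kappa>_sector: "norm (\<kappa> z) \<le> 2 * Re (\<kappa> z)" if "norm z < 1" for z
    unfolding \<kappa>_def using sector[OF eps_ball(2)[OF that]] by simp

  define g1 where "g1 z = z * exp (of_real (\<beta> ((norm z)\<^sup>2)) * \<kappa> z)" for z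
  define a1 where "a1 z = exp (of_real (\<beta> ((norm z)\<^sup>2)) * \<kappa> z) *
      ((1 + of_real (\<beta> ((norm z)\<^sup>2)) * (z * \<kappa>' z)) + of_real (\<beta>' ((norm z)\<^sup>2) * (norm z)\<^sup>2) * \<kappa> z)" for z
  define b1 where "b1 z = exp (of_real (\<beta> ((norm z)\<^sup>2)) * \<kappa> z) * (of_real (\<beta>' ((norm z)\<^sup>2)) * z\<^sup>2 * \<kappa> z)" for z
  have w1: "wirtinger g1 (a1 z) (b1 z) z" if "norm z < 1" for z
    unfolding g1_def a1_def b1_def by (rule wirtinger_twist[OF \<beta>(1) \<kappa>[OF that]])
  have c1: "continuous_on (ball 0 1) a1" "continuous_on (ball 0 1) b1"
    unfolding a1_def b1_def using cont\<kappa> cnorm[OF cont(1)] cnorm[OF \<beta>(2)]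
    by (auto intro!: continuous_intros)
  \<comment> \<open>Here \<open>z \<kappa>'\<close> is \<open>w deriv q w\<close> at \<open>w = \<epsilon> z\<close>, so \<open>A\<close> is within 1/2 of 1.\<close>
  have ab1: "norm (b1 z) < norm (a1 z)" if "norm z < 1" for z
  proof -
    define A where "A = 1 + of_real (\<beta> ((norm z)\<^sup>2)) * (z * \<kappa>' z)"
    define t where "t = \<beta>' ((norm z)\<^sup>2) * (norm z)\<^sup>2"
    have "norm (A - 1) = \<beta> ((norm z)\<^sup>2) * norm (of_real \<epsilon> * z * deriv q (of_real \<epsilon> * z))"
      using \<beta>(6) by (simp add: A_def \<kappa>'_def norm_mult)
    also have "\<dots> \<le> 1 * (1/2)"
      using \<beta>(6,7) small[OF eps_ball(2)[OF that]] by (intro mult_mono) auto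
    finally have "norm (of_real t * \<kappa> z) < norm (A + of_real t * \<kappa> z)"
      using \<beta>(3) \<kappa>_sector[OF that] by (intro norm_less_norm_add_sector) (auto simp: t_def)
    moreover have "norm (of_real (\<beta>' ((norm z)\<^sup>2)) * z\<^sup>2 * \<kappa> z) = norm (of_real t * \<kappa> z)"
      by (simp add: t_def norm_mult norm_power)
    ultimately show ?thesis
      unfolding a1_def b1_def A_def[symmetric] t_def[symmetric] norm_mult[of "exp _"] by simp
  qed

  define \<rho> where "\<rho> z = of_real (l ((norm z)\<^sup>2)) * z" for z :: complex
  define a2 where "a2 z = complex_of_real (l ((norm z)\<^sup>2) + l' ((norm z)\<^sup>2) * (norm z)\<^sup>2)" for z :: complex
  define b2 where "b2 z = of_real (l' ((norm z)\<^sup>2)) * z\<^sup>2" for z :: complex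
  have w2: "wirtinger \<rho> (a2 z) (b2 z) z" for z
    unfolding \<rho>_def a2_def b2_def by (rule wirtinger_radial_stretch[OF l])
  have c2: "continuous_on V a2" "continuous_on V b2" for V
    unfolding a2_def b2_def using cnorm[OF cont(2)] cnorm[OF cont(3)] by (auto intro!: continuous_intros)
  have ab2: "norm (b2 z) < norm (a2 z)" for z
  proof -
    have "norm (b2 z) = l' ((norm z)\<^sup>2) * (norm z)\<^sup>2" using l'_nonneg by (simp add: b2_def norm_mult norm_power)
    also have "\<dots> < l ((norm z)\<^sup>2) + l' ((norm z)\<^sup>2) * (norm z)\<^sup>2" using l_bounds(1)[of "(norm z)\<^sup>2"] eps by simp
    also have "\<dots> \<le> norm (a2 z)" unfolding a2_def norm_of_real by simp
    finally show ?thesis .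
  qed
  have norm\<rho>: "norm (\<rho> z) = l ((norm z)\<^sup>2) * norm z" for z
    using l_bounds(1)[of "(norm z)\<^sup>2"] eps by (simp add: \<rho>_def norm_mult)
  have \<rho>_ball: "\<rho> z \<in> ball 0 1" if "norm z < 1" for z
  proof -
    have "l ((norm z)\<^sup>2) * norm z \<le> 1 * norm z" using l_bounds by (intro mult_right_mono) auto
    then show ?thesis using that norm\<rho>[of z] by simp
  qed
  define H where "H w = of_real N * (w * exp (q w))" for w
  have H: "H holomorphic_on ball 0 1" unfolding H_def by (intro holomorphic_intros hol)
  define g2 where "g2 = H \<circ> \<rho>"

  define g where "g z = (if norm z < r2 then g1 z else g2 z)" for z
  \<comment> \<open>Between the radii \<open>r1\<close> and \<open>r2\<close> one has \<open>\<beta> = 1\<close> and \<open>l = \<epsilon>\<close>, so both formulas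
    give \<open>H (\<epsilon> z)\<close>; this open overlap lets differentiability be checked piece by piece.\<close>
  have agree: "g1 z = g2 z" if "r1 \<le> norm z" "norm z < r2" for z
  proof -
    have "r1\<^sup>2 \<le> (norm z)\<^sup>2" "(norm z)\<^sup>2 \<le> r2\<^sup>2" using that r r1 by (auto intro!: power_mono)
    then have "\<beta> ((norm z)\<^sup>2) = 1" "l ((norm z)\<^sup>2) = \<epsilon>" using \<beta>(5) s(4) by (auto simp: l_def)
    moreover have "exp (complex_of_real (ln (N * \<epsilon>))) = of_real (N * \<epsilon>)"
      using N eps unfolding exp_of_real by simp
    ultimately show ?thesis
      by (simp add: g1_def g2_def H_def \<rho>_def \<kappa>_def exp_add)
  qed
  define Z where "Z = {z. r1 < norm z} \<inter> ball (0::complex) 1"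
  have Z: "open Z" unfolding Z_def by (intro open_Int open_Collect_less continuous_intros) auto
  have gZ: "g z = g2 z" if "z \<in> Z" for z using that agree unfolding g_def Z_def by auto
  have gB: "g z = g1 z" if "z \<in> ball 0 r2" for z using that unfolding g_def by auto

  have C1g: "C1_on (ball 0 1) g"
  proof -
    have "C1_on (ball 0 1) g1" unfolding C1_on_def
      by (intro exI[of _ a1] exI[of _ b1] conjI ballI c1 w1) auto
    then have "C1_on (ball 0 r2) g1" by (rule C1_on_subset) (use r2 in auto)
    then have 1: "C1_on (ball 0 r2) g" by (rule C1_on_cong_open[OF _ open_ball gB])
    have "C1_on (ball 0 1) \<rho>" unfolding C1_on_def
      by (intro exI[of _ a2] exI[of _ b2] conjI ballI c2 w2)
    moreover have "C1_on (ball 0 1) H" using H by (intro C1_on_holomorphic) auto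
    ultimately have "C1_on (ball 0 1) g2"
      unfolding g2_def using \<rho>_ball by (intro C1_on_compose) auto
    then have "C1_on Z g2" by (rule C1_on_subset) (simp add: Z_def)
    then have 2: "C1_on Z g" by (rule C1_on_cong_open[OF _ Z gZ])
    have "C1_on (\<Union>{ball 0 r2, Z}) g" by (rule C1_on_Union) (use 1 2 Z in auto)
    moreover have "ball 0 1 \<subseteq> \<Union>{ball 0 r2, Z}" using r2 by (auto simp: Z_def)
    ultimately show ?thesis by (rule C1_on_subset)
  qed

  obtain k1 where k1: "0 \<le> k1" "k1 < 1" "\<And>z. z \<in> cball 0 r1 \<Longrightarrow> qc_at k1 g1 z"
  proof -
    have "cball 0 r1 \<subseteq> ball (0::complex) 1" using r1 by auto
    then have "continuous_on (cball 0 r1) a1" "continuous_on (cball 0 r1) b1"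
      using c1 continuous_on_subset by blast+
    then show ?thesis
      using qc_at_uniform_on_compact[of "cball 0 r1" a1 b1 g1] ab1 w1 r1 that by auto
  qed
  obtain k2 where k2: "0 \<le> k2" "k2 < 1" "\<And>z. z \<in> cball 0 1 \<Longrightarrow> qc_at k2 \<rho> z"
    using qc_at_uniform_on_compact[of "cball 0 1" a2 b2 \<rho>] c2 ab2 w2 by auto
  have qc: "qc_at (max k1 k2) g z" if z: "norm z < 1" for z
  proof (cases "norm z \<le> r1")
    case True
    then have "qc_at (max k1 k2) g1 z" by (intro qc_at_mono[OF k1(3)]) auto
    then show ?thesis
      by (rule qc_at_cong_open[of _ _ _ "ball 0 r2"]) (use True r2 gB in auto)
  next
    case False
    have "qc_at (max k1 k2) \<rho> z" using z by (intro qc_at_mono[OF k2(3)]) auto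
    then have "qc_at (max k1 k2) g2 z" unfolding g2_def
      using \<rho>_ball[OF z] by (intro qc_at_conformal_compose qc_at_holomorphic[OF H]) auto
    then show ?thesis
      by (rule qc_at_cong_open[of _ _ _ Z]) (use False z Z gZ in \<open>auto simp: Z_def\<close>)
  qed

  show thesis
  proof (rule that[of "max k1 k2" r3 g])
    show "g z = z" if "norm z \<le> r" for z
    proof -
      have "(norm z)\<^sup>2 \<le> r\<^sup>2" using that by (intro power_mono) auto
      then show ?thesis using that r1 r2 \<beta>(4) by (simp add: g_def g1_def)
    qed
    show "g z = of_real N * (z * exp (q z))" if "r3 \<le> norm z" "norm z < 1" for z
    proof -
      have "r3\<^sup>2 \<le> (norm z)\<^sup>2" using that r r1 r2 r3 by (intro power_mono) auto
      then show ?thesis using that r3 s(5) by (simp add: g_def g2_def H_def \<rho>_def l_def)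
    qed
    show "norm z \<le> norm (g z)" if z: "norm z < 1" for z
    proof (cases "norm z < r2")
      case True
      have "0 \<le> Re (\<kappa> z)" using \<kappa>_sector[OF z] norm_ge_zero[of "\<kappa> z"] by linarith
      then have "0 \<le> \<beta> ((norm z)\<^sup>2) * Re (\<kappa> z)" by (intro mult_nonneg_nonneg \<beta>(6))
      then have "norm z * 1 \<le> norm z * exp (\<beta> ((norm z)\<^sup>2) * Re (\<kappa> z))"
        by (intro mult_left_mono) auto
      then show ?thesis using True by (simp add: g_def g1_def norm_mult)
    next
      case False
      have "\<epsilon> * r \<le> l ((norm z)\<^sup>2) * norm z"
        using False l_bounds(1)[of "(norm z)\<^sup>2"] eps r r1 r2 by (intro mult_mono) auto
      then have "2 \<le> norm (g2 z)"
        using large[of "\<rho> z"] \<rho>_ball[OF z] N by (simp add: norm\<rho> g2_def H_def norm_mult)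
      then show ?thesis using False z by (simp add: g_def)
    qed
  qed (use k1 k2 r r1 r2 r3 C1g qc in auto)
qed

section \<open>The expanding extension of the inverse branches\<close>

text \<open>The product has a single zero in the disk, at 0, and it is simple because \<open>\<phi>\<close> is injective.
Divided by \<open>z\<close> it becomes zero-free on a contractible domain and has a holomorphic logarithm.\<close>

lemma root_product_eq_id_times_exp:
  fixes \<phi> :: "complex \<Rightarrow> complex"
  assumes hol: "\<phi> holomorphic_on ball 0 1" and inj: "inj_on \<phi> (ball 0 1)"
    and ne: "\<And>z j. z \<in> ball 0 1 \<Longrightarrow> j \<in> J \<Longrightarrow> \<phi> z \<noteq> p j"
  obtains q where "q holomorphic_on ball 0 1"
    "\<And>z. z \<in> ball 0 1 \<Longrightarrow> (\<phi> z - \<phi> 0) * (\<Prod>j\<in>J. \<phi> z - p j) = z * exp (q z)"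
proof -
  define d where "d z = (if z = 0 then deriv \<phi> 0 else (\<phi> z - \<phi> 0) / (z - 0))" for z
  have d_hol: "d holomorphic_on ball 0 1"
    unfolding d_def by (rule pole_lemma_open[OF hol]) simp
  have "deriv \<phi> 0 \<noteq> 0" by (rule holomorphic_injective_imp_regular[OF hol _ inj]) auto
  then have d_nz: "d z \<noteq> 0" if "z \<in> ball 0 1" for z
    using that inj_onD[OF inj, of z 0] unfolding d_def by auto
  have "(\<lambda>z. d z * (\<Prod>j\<in>J. \<phi> z - p j)) holomorphic_on ball 0 1"
    by (intro holomorphic_intros d_hol hol)
  moreover have "d z * (\<Prod>j\<in>J. \<phi> z - p j) \<noteq> 0" if "z \<in> ball 0 1" for z
  proof -
    have "(\<Prod>j\<in>J. \<phi> z - p j) \<noteq> 0"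
      using ne[OF that] by (cases "finite J") auto
    then show ?thesis using d_nz[OF that] by simp
  qed
  ultimately obtain q where q: "q holomorphic_on ball 0 1"
    "\<And>z. z \<in> ball 0 1 \<Longrightarrow> d z * (\<Prod>j\<in>J. \<phi> z - p j) = exp (q z)"
    using contractible_imp_holomorphic_log[of _ "ball 0 1", OF _ convex_imp_contractible[OF convex_ball]]
    by (smt (verit, best))
  have "(\<phi> z - \<phi> 0) * (\<Prod>j\<in>J. \<phi> z - p j) = z * exp (q z)" if "z \<in> ball 0 1" for z
    using q(2)[OF that, symmetric] by (simp add: d_def)
  with q(1) show thesis by (rule that)
qed

lemma small_deriv_near_0:
  assumes "q holomorphic_on ball 0 1"
  shows "\<exists>\<delta>>0. \<forall>w. norm w < \<delta> \<longrightarrow> norm (w * deriv q w) \<le> 1/2"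
proof -
  have "continuous_on (ball 0 1) (deriv q)"
    using assms by (intro holomorphic_on_imp_continuous_on holomorphic_deriv) auto
  then have "isCont (deriv q) 0" by (simp add: continuous_on_eq_continuous_at)
  then have "isCont (\<lambda>w. w * deriv q w) 0" by (intro continuous_intros)
  then obtain \<delta> where "\<delta> > 0" "\<And>w. dist w 0 < \<delta> \<Longrightarrow> dist (w * deriv q w) (0 * deriv q 0) < 1/2"
    unfolding continuous_at_eps_delta by (metis half_gt_zero_iff zero_less_one)
  then show ?thesis by (intro exI[of _ \<delta>]) (auto intro: less_imp_le)
qed

text \<open>Outside the disk of radius 2 every factor is at least \<open>\<bar>w\<bar> - 1 \<ge> 1\<close>; the rest of \<open>C\<close>
is compact and contains no zero.\<close>

lemma root_product_lower_bound:
  fixes p :: "'i \<Rightarrow> complex"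
  assumes I: "finite I" "I \<noteq> {}" and p: "\<And>i. i \<in> I \<Longrightarrow> norm (p i) \<le> 1"
    and C: "closed C" "\<And>i. i \<in> I \<Longrightarrow> p i \<notin> C"
  obtains c where "0 < c" "\<And>w. w \<in> C \<Longrightarrow> c * (1 + norm w) \<le> norm (\<Prod>i\<in>I. w - p i)"
proof -
  define P where "P w = norm (\<Prod>i\<in>I. w - p i)" for w
  have far: "(1 + norm w) / 3 \<le> P w" if w: "2 \<le> norm w" for w
  proof -
    have "norm w - 1 \<le> (norm w - 1) ^ card I"
      using w I by (intro self_le_power) (auto simp: Suc_le_eq card_gt_0_iff)
    also have "\<dots> = (\<Prod>i\<in>I. norm w - 1)" by simp
    also have "\<dots> \<le> (\<Prod>i\<in>I. norm (w - p i))"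
    proof (rule prod_mono)
      fix i assume "i \<in> I"
      then show "0 \<le> norm w - 1 \<and> norm w - 1 \<le> norm (w - p i)"
        using w p[of i] norm_triangle_ineq2[of w "p i"] by auto
    qed
    also have "\<dots> = P w" by (simp add: P_def prod_norm)
    finally show ?thesis using w by simp
  qed
  have "\<exists>d>0. \<forall>w\<in>C \<inter> cball 0 2. d \<le> P w"
  proof (cases "C \<inter> cball 0 2 = {}")
    case True then show ?thesis by (intro exI[of _ 1]) auto
  next
    case False
    have "compact (C \<inter> cball 0 2)" using C by (simp add: closed_Int_compact)
    moreover have "continuous_on (C \<inter> cball 0 2) P" unfolding P_def by (intro continuous_intros)
    ultimately obtain w where w: "w \<in> C \<inter> cball 0 2" "\<forall>v\<in>C \<inter> cball 0 2. P w \<le> P v"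
      using continuous_attains_inf[OF _ False] by blast
    have "P w > 0" using w(1) C(2) I by (auto simp: P_def)
    then show ?thesis using w by blast
  qed
  then obtain d where d: "d > 0" "\<And>w. w \<in> C \<Longrightarrow> norm w \<le> 2 \<Longrightarrow> d \<le> P w" by auto
  show thesis
  proof
    show "0 < min (1/3) (d/3)" using d by simp
    fix w assume w: "w \<in> C"
    show "min (1/3) (d/3) * (1 + norm w) \<le> norm (\<Prod>i\<in>I. w - p i)"
    proof (cases "norm w \<le> 2")
      case True
      have "min (1/3) (d/3) * (1 + norm w) \<le> d/3 * 3" using True d by (intro mult_mono) auto
      then show ?thesis using d(2)[OF w True] by (simp add: P_def)
    next
      case False
      have "min (1/3) (d/3) * (1 + norm w) \<le> 1/3 * (1 + norm w)" by (intro mult_right_mono) auto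
      then show ?thesis using far[of w] False unfolding P_def by linarith
    qed
  qed
qed

lemma compact_subset_smaller_ball:
  fixes T :: "complex set"
  assumes "compact T" "T \<subseteq> ball 0 1"
  obtains r where "0 < r" "r < 1" "T \<subseteq> ball 0 r"
proof (cases "T = {}")
  case True then show thesis using that[of "1/2"] by auto
next
  case False
  obtain x where x: "x \<in> T" "\<And>y. y \<in> T \<Longrightarrow> norm y \<le> norm x"
    using continuous_attains_sup[OF assms(1) False, of norm] by (auto intro: continuous_intros)
  have "norm x < 1" using x assms by auto
  then obtain r where "norm x < r" "r < 1" using dense by blast
  then show thesis using x(2) that[of r] norm_ge_zero[of x] by force
qed

text \<open>The two conditions on the images of the open disk extend to the closed disk, since continuity
gives \<open>\<phi> (closure B) \<subseteq> closure (\<phi> B)\<close>.\<close>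

lemma disk_ifs_images:
  assumes "conformal_disk_ifs m \<phi>" "strong_disk_open_set_condition m \<phi>" and i: "i \<in> {1..m}"
  shows "continuous_on (cball 0 1) (\<phi> i)" "\<phi> i holomorphic_on ball 0 1" "inj_on (\<phi> i) (ball 0 1)"
    "\<phi> i ` cball 0 1 \<subseteq> ball 0 1"
    "\<And>j. j \<in> {1..m} \<Longrightarrow> i \<noteq> j \<Longrightarrow> \<phi> i ` cball 0 1 \<inter> \<phi> j ` cball 0 1 = {}"
proof -
  have cont: "continuous_on (cball 0 1) (\<phi> j)" if "j \<in> {1..m}" for j
    using assms(1) that lipschitz_on_continuous_on unfolding conformal_disk_ifs_def ifs_def by blast
  show "continuous_on (cball 0 1) (\<phi> i)" by (rule cont[OF i])
  show "\<phi> i holomorphic_on ball 0 1" "inj_on (\<phi> i) (ball 0 1)"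
    using assms(1) i unfolding conformal_disk_ifs_def by blast+
  have sub: "\<phi> j ` cball 0 1 \<subseteq> closure (\<phi> j ` ball 0 1)" if "j \<in> {1..m}" for j
    using image_closure_subset[of "ball 0 1" "\<phi> j" "closure (\<phi> j ` ball 0 1)"] cont[OF that]
    by (simp add: closure_subset)
  show "\<phi> i ` cball 0 1 \<subseteq> ball 0 1"
    using sub[OF i] assms(2) i unfolding strong_disk_open_set_condition_def by blast
  show "\<phi> i ` cball 0 1 \<inter> \<phi> j ` cball 0 1 = {}" if "j \<in> {1..m}" "i \<noteq> j" for j
    using sub[OF i] sub[OF that(1)] assms(2) i that unfolding strong_disk_open_set_condition_def by blast
qed

text \<open>Let \<open>P\<close> be the monic polynomial with roots \<open>\<phi>\<^sub>i 0\<close>.  The map \<open>F\<close> is \<open>N P\<close> off the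
images \<open>V\<^sub>i\<close> of the unit disk, and \<open>g\<^sub>i \<circ> \<phi>\<^sub>i\<^sup>-\<^sup>1\<close> on \<open>V\<^sub>i\<close>, where \<open>g\<^sub>i\<close> interpolates
between the identity and \<open>N P \<circ> \<phi>\<^sub>i\<close>.  On \<open>V\<^sub>i\<close> it therefore is the inverse of \<open>\<phi>\<^sub>i\<close> in the
core and joins up with \<open>N P\<close> near the boundary.  The radius \<open>r\<close> is so close to 1 that all images lie in
the disk of radius \<open>r\<close>.

The constants are chosen in this order: \<open>\<epsilon>\<close> depends on the logarithms \<open>q\<^sub>i\<close> of
\<open>P (\<phi>\<^sub>i z) / z\<close>, and \<open>N\<close> depends on \<open>\<epsilon>\<close>.  A large \<open>N\<close> makes \<open>N P\<close> expanding away
from the roots, and it enters the logarithms only as the additive constant \<open>ln N\<close>.\<close>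

lemma expanding_extension:
  assumes "conformal_disk_ifs m \<phi>" "strong_disk_open_set_condition m \<phi>"
  obtains F r k where "0 < r" "r < 1" "0 \<le> k" "k < 1"
    "\<And>i. i \<in> {1..m} \<Longrightarrow> \<phi> i ` cball 0 1 \<subseteq> ball 0 r"
    "C1_on UNIV F"
    "\<And>i z. i \<in> {1..m} \<Longrightarrow> norm z \<le> r \<Longrightarrow> F (\<phi> i z) = z"
    "\<And>z. norm (F z) \<le> r \<Longrightarrow> \<exists>i\<in>{1..m}. z \<in> \<phi> i ` cball 0 r"
    "\<And>z. r \<le> norm z \<Longrightarrow> 2 * norm z \<le> norm (F z)"
    "\<And>z. r \<le> norm z \<Longrightarrow> qc_at 0 F z"
    "\<And>z. qc_at k F z"
    "\<And>z. qc_at 0 F z \<or> r \<le> norm (F z)"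
proof -
  define I where "I = {1..m}"
  have I: "finite I" "I \<noteq> {}"
    using assms(1) by (auto simp: I_def conformal_disk_ifs_def ifs_def)
  note im = disk_ifs_images[OF assms, folded I_def]
  have ball_cball: "ball 0 1 \<subseteq> cball (0::complex) 1" by auto
  have disj: "\<phi> i y \<noteq> \<phi> j z" if "i \<in> I" "j \<in> I" "i \<noteq> j" "norm y \<le> 1" "norm z \<le> 1" for i j y z
  proof
    assume "\<phi> i y = \<phi> j z"
    moreover have "\<phi> i y \<in> \<phi> i ` cball 0 1" "\<phi> j z \<in> \<phi> j ` cball 0 1" using that by auto
    ultimately show False using im(5)[OF that(1,2,3)] by (simp add: disjoint_iff)
  qed

  have "compact (\<Union>i\<in>I. \<phi> i ` cball 0 1)"
    using I im(1) by (intro compact_UN compact_continuous_image) auto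
  then obtain r where r: "0 < r" "r < 1" and r_sub: "(\<Union>i\<in>I. \<phi> i ` cball 0 1) \<subseteq> ball 0 r"
    by (rule compact_subset_smaller_ball) (use im(4) in auto)

  define P where "P w = (\<Prod>i\<in>I. w - \<phi> i 0)" for w
  have "\<forall>i\<in>I. \<exists>q. q holomorphic_on ball 0 1 \<and> (\<forall>z\<in>ball 0 1. P (\<phi> i z) = z * exp (q z))"
  proof
    fix i assume i: "i \<in> I"
    obtain q where q: "q holomorphic_on ball 0 1"
      "\<And>z. z \<in> ball 0 1 \<Longrightarrow> (\<phi> i z - \<phi> i 0) * (\<Prod>j\<in>I-{i}. \<phi> i z - \<phi> j 0) = z * exp (q z)"
      by (rule root_product_eq_id_times_exp[OF im(2)[OF i] im(3)[OF i], of "I - {i}" "\<lambda>j. \<phi> j 0"])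
        (use disj[OF i] in auto)
    have "P (\<phi> i z) = z * exp (q z)" if "z \<in> ball 0 1" for z
      using q(2)[OF that] I i by (simp add: P_def prod.remove)
    then show "\<exists>q. q holomorphic_on ball 0 1 \<and> (\<forall>z\<in>ball 0 1. P (\<phi> i z) = z * exp (q z))"
      using q(1) by blast
  qed
  then obtain q where q: "\<And>i. i \<in> I \<Longrightarrow> q i holomorphic_on ball 0 1"
    "\<And>i z. i \<in> I \<Longrightarrow> z \<in> ball 0 1 \<Longrightarrow> P (\<phi> i z) = z * exp (q i z)"
    using bchoice[of I "\<lambda>i q. q holomorphic_on ball 0 1 \<and> (\<forall>z\<in>ball 0 1. P (\<phi> i z) = z * exp (q z))"]
    by blast

  obtain \<delta> where \<delta>: "\<And>i. i \<in> I \<Longrightarrow> 0 < \<delta> i"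
    "\<And>i w. i \<in> I \<Longrightarrow> norm w < \<delta> i \<Longrightarrow> norm (w * deriv (q i) w) \<le> 1/2"
    using bchoice[of I "\<lambda>i d. d > 0 \<and> (\<forall>w. norm w < d \<longrightarrow> norm (w * deriv (q i) w) \<le> 1/2)"]
      small_deriv_near_0[OF q(1)] by blast
  obtain \<epsilon> where eps: "0 < \<epsilon>" "\<epsilon> < Min (insert 1 (\<delta> ` I))"
    using dense[of 0 "Min (insert 1 (\<delta> ` I))"] \<delta>(1) I by auto
  then have eps1: "\<epsilon> < 1" and eps\<delta>: "\<And>i. i \<in> I \<Longrightarrow> \<epsilon> < \<delta> i" using I by auto
  have "bounded (\<Union>i\<in>I. q i ` cball 0 \<epsilon>)"
  proof (intro bounded_UN I(1) ballI compact_imp_bounded compact_continuous_image)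
    fix i assume "i \<in> I"
    then show "continuous_on (cball 0 \<epsilon>) (q i)"
      using q(1) eps1 by (intro continuous_on_subset[OF holomorphic_on_imp_continuous_on]) auto
  qed auto
  then obtain M where "\<forall>w\<in>(\<Union>i\<in>I. q i ` cball 0 \<epsilon>). norm w \<le> M"
    unfolding bounded_iff by blast
  then have M: "\<And>i w. i \<in> I \<Longrightarrow> norm w \<le> \<epsilon> \<Longrightarrow> norm (q i w) \<le> M" by auto

  have open_image: "open (\<phi> i ` ball 0 s)" if "i \<in> I" "s \<le> 1" for i s
    using im(2,3)[OF that(1)] that(2) subset_ball[of s 1 0]
    by (intro open_mapping_thm3) (auto intro: holomorphic_on_subset inj_on_subset)
  have er: "0 < \<epsilon> * r" "\<epsilon> * r < 1" using eps eps1 r mult_strict_mono[of \<epsilon> 1 r 1] by auto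
  define C where "C = - (\<Union>i\<in>I. \<phi> i ` ball 0 (\<epsilon> * r))"
  have "closed C" unfolding C_def using open_image er by (intro closed_Compl open_UN) auto
  moreover have "norm (\<phi> i 0) \<le> 1" if "i \<in> I" for i using im(4)[OF that] by (auto simp: image_subset_iff intro: less_imp_le)
  moreover have "\<phi> i 0 \<notin> C" if "i \<in> I" for i
  proof -
    have "\<phi> i 0 \<in> \<phi> i ` ball 0 (\<epsilon> * r)" using er by (intro imageI) simp
    then show ?thesis using that unfolding C_def by blast
  qed
  ultimately obtain c where c: "0 < c" "\<And>w. w \<in> C \<Longrightarrow> c * (1 + norm w) \<le> norm (P w)"
    using root_product_lower_bound[OF I, of "\<lambda>i. \<phi> i 0" C] unfolding P_def by metis

  \<comment> \<open>The first bound makes \<open>N P\<close> expanding on \<open>C\<close>.  The second gives \<open>ln (N \<epsilon>) \<ge> 3 M\<close>,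
    which turns \<open>\<bar>q\<bar> \<le> M\<close> into the sector condition: \<open>\<bar>\<kappa>\<bar> \<le> ln (N \<epsilon>) + M\<close> and
    \<open>2 Re \<kappa> \<ge> 2 ln (N \<epsilon>) - 2 M\<close>.\<close>
  define N where "N = max (2 / c) (exp (3 * M) / \<epsilon>)"
  have N: "0 < N" using c by (simp add: N_def less_max_iff_disj)
  have "exp (3 * M) / \<epsilon> \<le> N" by (simp add: N_def)
  then have "exp (3 * M) \<le> N * \<epsilon>" using eps by (simp add: divide_le_eq)
  then have lnN: "3 * M \<le> ln (N * \<epsilon>)" using N eps by (simp add: ln_ge_iff)
  have "2 / c \<le> N" by (simp add: N_def)
  then have Nc: "2 \<le> N * c" using c by (simp add: divide_le_eq)
  have P_large: "2 + 2 * norm w \<le> N * norm (P w)" if "w \<in> C" for w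
  proof -
    have "2 * (1 + norm w) \<le> N * c * (1 + norm w)" using Nc by (intro mult_right_mono) auto
    also have "\<dots> \<le> N * norm (P w)" using c(2)[OF that] N by (simp add: mult.assoc)
    finally show ?thesis by simp
  qed
  have in_C: "\<phi> i w \<in> C" if "i \<in> I" "\<epsilon> * r \<le> norm w" "norm w < 1" for i w
  proof -
    have "\<phi> i w \<noteq> \<phi> j y" if j: "j \<in> I" "norm y < \<epsilon> * r" for j y
    proof (cases "i = j")
      case True
      then show ?thesis using inj_onD[OF im(3)[OF \<open>i \<in> I\<close>], of w y] \<open>\<epsilon> * r \<le> norm w\<close> \<open>norm w < 1\<close> j er by auto
    next
      case False
      then show ?thesis using disj[OF \<open>i \<in> I\<close> j(1)] \<open>norm w < 1\<close> j er by auto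
    qed
    then show ?thesis by (simp add: C_def image_iff)
  qed

  have "\<forall>i\<in>I. \<exists>g \<rho> k. 0 \<le> k \<and> k < 1 \<and> \<rho> < 1 \<and> C1_on (ball 0 1) g \<and>
    (\<forall>z. norm z \<le> r \<longrightarrow> g z = z) \<and>
    (\<forall>z. \<rho> \<le> norm z \<longrightarrow> norm z < 1 \<longrightarrow> g z = of_real N * P (\<phi> i z)) \<and>
    (\<forall>z. norm z < 1 \<longrightarrow> qc_at k g z) \<and> (\<forall>z. norm z < 1 \<longrightarrow> norm z \<le> norm (g z))" (is "\<forall>i\<in>I. \<exists>g \<rho> k. ?Q i g \<rho> k")
  proof
    fix i assume i: "i \<in> I"
    show "\<exists>g \<rho> k. ?Q i g \<rho> k"
    proof (rule disc_interpolation[OF q(1)[OF i] r eps(1) eps1 N])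
      fix w :: complex assume w: "norm w \<le> \<epsilon>"
      then show "norm (w * deriv (q i) w) \<le> 1/2" using \<delta>(2)[OF i] eps\<delta>[OF i] by auto
      let ?L = "ln (N * \<epsilon>)"
      have "norm (q i w) \<le> M" by (rule M[OF i w])
      moreover have "\<bar>Re (q i w)\<bar> \<le> norm (q i w)" by (rule abs_Re_le_cmod)
      moreover have "norm (q i w + of_real ?L) \<le> norm (q i w) + ?L"
        using norm_triangle_ineq[of "q i w" "of_real ?L"] lnN M[OF i w] norm_ge_zero[of "q i w"] by simp
      ultimately show "norm (q i w + of_real ?L) \<le> 2 * Re (q i w + of_real ?L)"
        using lnN by simp
    next
      fix w :: complex assume w: "\<epsilon> * r \<le> norm w" "norm w < 1"
      have P: "P (\<phi> i w) = w * exp (q i w)" using q(2)[OF i] w by simp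
      show "2 \<le> N * norm (w * exp (q i w))"
        using P_large[OF in_C[OF i w]] norm_ge_zero[of "\<phi> i w"] unfolding P by linarith
    next
      fix k \<rho> g
      assume *: "0 \<le> k" "k < 1" "\<rho> < (1::real)" "C1_on (ball 0 1) g" "\<And>z. norm z \<le> r \<Longrightarrow> g z = z"
        "\<And>z. \<rho> \<le> norm z \<Longrightarrow> norm z < 1 \<Longrightarrow> g z = of_real N * (z * exp (q i z))"
        "\<And>z. norm z < 1 \<Longrightarrow> qc_at k g z" "\<And>z. norm z < 1 \<Longrightarrow> norm z \<le> norm (g z)"
      have "g z = of_real N * P (\<phi> i z)" if "\<rho> \<le> norm z" "norm z < 1" for z
        using *(6)[OF that] q(2)[OF i, of z] that by simp
      with * show "\<exists>g \<rho> k. ?Q i g \<rho> k" by blast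
    qed
  qed
  then obtain g where "\<forall>i\<in>I. \<exists>\<rho> k. ?Q i (g i) \<rho> k" by (rule bchoice[THEN exE])
  then obtain \<rho> where "\<forall>i\<in>I. \<exists>k. ?Q i (g i) (\<rho> i) k" by (rule bchoice[THEN exE])
  then obtain k where Q: "\<forall>i\<in>I. ?Q i (g i) (\<rho> i) (k i)" by (rule bchoice[THEN exE])

  have "\<exists>\<psi>. \<psi> holomorphic_on \<phi> i ` ball 0 1 \<and> (\<forall>z\<in>ball 0 1. \<psi> (\<phi> i z) = z)" if "i \<in> I" for i
    using holomorphic_has_inverse[OF im(2)[OF that] open_ball im(3)[OF that]] by metis
  then obtain \<psi> where \<psi>: "\<And>i. i \<in> I \<Longrightarrow> \<psi> i holomorphic_on \<phi> i ` ball 0 1"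
    "\<And>i z. i \<in> I \<Longrightarrow> z \<in> ball 0 1 \<Longrightarrow> \<psi> i (\<phi> i z) = z"
    by metis
  define V where "V i = \<phi> i ` ball 0 1" for i
  have V: "open (V i)" if "i \<in> I" for i unfolding V_def by (rule open_image[OF that]) simp
  define F where "F z = (if z \<in> \<Union>(V ` I) then let i = (THE i. i \<in> I \<and> z \<in> V i) in g i (\<psi> i z)
     else of_real N * P z)" for z
  have FV: "F z = (g i \<circ> \<psi> i) z" if "i \<in> I" "z \<in> V i" for i z
  proof -
    have "(THE i. i \<in> I \<and> z \<in> V i) = i"
    proof (rule the_equality)
      fix j assume j: "j \<in> I \<and> z \<in> V j"
      then show "j = i" using im(5)[of i j] ball_cball that unfolding V_def by blast
    qed (use that in simp)
    then show ?thesis using that unfolding F_def by auto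
  qed
  have F\<phi>: "F (\<phi> i y) = g i y" if "i \<in> I" "norm y < 1" for i y
    using FV[OF that(1), of "\<phi> i y"] \<psi>(2)[OF that(1)] that(2) by (simp add: V_def)
  \<comment> \<open>\<open>W\<close> reaches into each \<open>V i\<close>, to where \<open>g i\<close> already agrees with the polynomial.  The
    open sets \<open>V i\<close> and \<open>W\<close> cover the plane, and \<open>F\<close> is smooth on each of them.\<close>
  define W where "W = - (\<Union>i\<in>I. \<phi> i ` cball 0 (\<rho> i))"
  have "closed (\<phi> i ` cball 0 (\<rho> i))" if "i \<in> I" for i
  proof -
    have "cball 0 (\<rho> i) \<subseteq> cball (0::complex) 1" using Q that by auto
    then show ?thesis
      using im(1)[OF that] by (intro compact_imp_closed compact_continuous_image) (auto intro: continuous_on_subset)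
  qed
  then have W: "open W" unfolding W_def using I by (intro open_Compl closed_UN) auto
  have FW: "F z = of_real N * P z" if "z \<in> W" for z
  proof (cases "z \<in> \<Union>(V ` I)")
    case True
    then obtain i y where i: "i \<in> I" and y: "norm y < 1" "z = \<phi> i y" by (auto simp: V_def)
    have "\<rho> i \<le> norm y" using that i y(2) by (auto simp: W_def not_less[symmetric])
    then show ?thesis using Q i y F\<phi>[OF i y(1)] by auto
  next
    case False then show ?thesis by (simp add: F_def)
  qed
  have V_or_W: "z \<in> W" if "\<And>i. i \<in> I \<Longrightarrow> z \<notin> V i" for z
  proof -
    have "\<phi> i ` cball 0 (\<rho> i) \<subseteq> V i" if "i \<in> I" for i using Q that unfolding V_def by (intro image_mono) auto
    then show ?thesis using that unfolding W_def by blast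
  qed
  have holP: "(\<lambda>z. of_real N * P z) holomorphic_on UNIV"
    unfolding P_def by (intro holomorphic_intros)
  have qcW: "qc_at 0 F z" if "z \<in> W" for z
    using qc_at_holomorphic[OF holP open_UNIV] by (rule qc_at_cong_open[OF _ W that FW]) auto
  have not_V: "z \<notin> V i" if "i \<in> I" "r \<le> norm z" for i z
    using r_sub ball_cball that unfolding V_def by fastforce
  have not_V_C: "z \<in> C" if "\<And>i. i \<in> I \<Longrightarrow> z \<notin> V i" for z
    using that er unfolding C_def V_def by fastforce
  have large: "2 + 2 * norm z \<le> norm (F z)" if "\<And>i. i \<in> I \<Longrightarrow> z \<notin> V i" for z
    using P_large[OF not_V_C[OF that]] FW[OF V_or_W[OF that]] N by (simp add: norm_mult)

  define K where "K = Max (k ` I)"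
  have K: "0 \<le> K" "K < 1" "\<And>i. i \<in> I \<Longrightarrow> k i \<le> K"
    using Q I unfolding K_def by (auto simp: Max_ge_iff)

  show thesis
  proof (rule that[of r K F, folded I_def])
    show "\<phi> i ` cball 0 1 \<subseteq> ball 0 r" if "i \<in> I" for i using r_sub that by blast
    show "C1_on UNIV F"
    proof -
      have "C1_on (V i) F" if i: "i \<in> I" for i
      proof -
        have "C1_on (V i) (\<psi> i)" using \<psi>(1)[OF i, folded V_def] V[OF i] by (rule C1_on_holomorphic)
        moreover have "C1_on (ball 0 1) (g i)" using Q i by blast
        moreover have "\<psi> i ` V i \<subseteq> ball 0 1" using \<psi>(2)[OF i] by (auto simp: V_def)
        ultimately have "C1_on (V i) (g i \<circ> \<psi> i)" by (rule C1_on_compose)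
        then show ?thesis by (rule C1_on_cong_open[OF _ V[OF i] FV[OF i]])
      qed
      moreover have "C1_on W F"
        using C1_on_subset[OF C1_on_holomorphic[OF holP open_UNIV] subset_UNIV]
        by (rule C1_on_cong_open[OF _ W FW])
      ultimately have "C1_on (\<Union>(insert W (V ` I))) F"
        using V W by (intro C1_on_Union) auto
      moreover have "\<Union>(insert W (V ` I)) = UNIV" using V_or_W by blast
      ultimately show ?thesis by simp
    qed
    show "F (\<phi> i z) = z" if "i \<in> I" "norm z \<le> r" for i z
      using F\<phi>[OF that(1), of z] Q that r by auto
    show "\<exists>i\<in>I. z \<in> \<phi> i ` cball 0 r" if Fz: "norm (F z) \<le> r" for z
    proof (cases "\<exists>i\<in>I. z \<in> V i")
      case True
      then obtain i y where i: "i \<in> I" and y: "norm y < 1" "z = \<phi> i y" by (auto simp: V_def)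
      then have "norm y \<le> norm (F z)" using Q F\<phi>[OF i y(1)] by auto
      then have "y \<in> cball 0 r" using Fz by simp
      then show ?thesis using i y(2) by blast
    next
      case False
      then have "2 + 2 * norm z \<le> norm (F z)" by (intro large) auto
      then show ?thesis using Fz r norm_ge_zero[of z] by linarith
    qed
    show "2 * norm z \<le> norm (F z)" if "r \<le> norm z" for z
    proof -
      have "2 + 2 * norm z \<le> norm (F z)" using large[OF not_V] that by blast
      then show ?thesis by simp
    qed
    show "qc_at 0 F z" if "r \<le> norm z" for z
      using qcW[OF V_or_W] not_V that by blast
    have cases: "z \<in> W \<or> (\<exists>i\<in>I. \<exists>y. norm y < 1 \<and> z = \<phi> i y)" for z
    proof (cases "\<exists>i\<in>I. z \<in> V i")
      case True
      then obtain i y where "i \<in> I" "norm y < 1" "z = \<phi> i y" by (auto simp: V_def)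
      then show ?thesis by blast
    next
      case False then show ?thesis using V_or_W[of z] by blast
    qed
    show "qc_at K F z" for z
      using cases[of z]
    proof (elim disjE bexE exE conjE)
      assume "z \<in> W" then show ?thesis using qc_at_mono[OF qcW K(1)] by blast
    next
      fix i y assume i: "i \<in> I" and y: "norm y < 1" "z = \<phi> i y"
      have zV: "z \<in> V i" using y by (auto simp: V_def)
      have "qc_at (k i) (g i) (\<psi> i z)" using Q i y \<psi>(2)[OF i, of y] by auto
      then have "qc_at (k i) (g i \<circ> \<psi> i) z"
        using \<psi>(1)[OF i, folded V_def] V[OF i] zV by (intro qc_at_compose_conformal qc_at_holomorphic[of "\<psi> i" "V i"])
      then have "qc_at (k i) F z" by (rule qc_at_cong_open[OF _ V[OF i] zV FV[OF i]])
      then show ?thesis by (rule qc_at_mono[OF _ K(3)[OF i]])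
    qed
    show "qc_at 0 F z \<or> r \<le> norm (F z)" for z
      using cases[of z]
    proof (elim disjE bexE exE conjE)
      assume "z \<in> W" then show ?thesis using qcW by blast
    next
      fix i y assume i: "i \<in> I" and y: "norm y < 1" "z = \<phi> i y"
      show ?thesis
      proof (cases "norm y < r")
        case True
        have "qc_at 0 (\<psi> i) z"
          using \<psi>(1)[OF i, folded V_def] V[OF i] by (rule qc_at_holomorphic) (use y in \<open>auto simp: V_def\<close>)
        then have "qc_at 0 F z"
        proof (rule qc_at_cong_open[OF _ open_image[OF i less_imp_le[OF r(2)]]])
          show "z \<in> \<phi> i ` ball 0 r" using True y by auto
          fix w assume "w \<in> \<phi> i ` ball 0 r"
          then obtain x where "norm x < r" "w = \<phi> i x" by auto
          then show "F w = \<psi> i w" using F\<phi>[OF i, of x] Q i r \<psi>(2)[OF i, of x] by auto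
        qed
        then show ?thesis ..
      next
        case False
        then have "r \<le> norm (F z)" using Q i y F\<phi>[OF i y(1)] by force
        then show ?thesis ..
      qed
    qed
  qed (use r K in auto)
qed

section \<open>Normality with values in the sphere\<close>

lemma dist_stereo_infinity: "(dist (stereo z) (0, 1))\<^sup>2 = 4 / (1 + (norm z)\<^sup>2)"
proof -
  define n where "n = (norm z)\<^sup>2"
  have n: "1 + n \<noteq> 0" and n0: "0 \<le> n" by (simp_all add: n_def add_nonneg_eq_0_iff)
  have "(norm z * 2 / (1 + n))\<^sup>2 = 4 * n / (1 + n)\<^sup>2"
    by (simp add: power_divide power_mult_distrib n_def)
  moreover have "(1 - (n - 1) / (n + 1))\<^sup>2 = 4 / (1 + n)\<^sup>2"
  proof -
    have "1 - (n - 1) / (n + 1) = 2 / (1 + n)" using n by (simp add: field_simps)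
    then show ?thesis by (simp add: power_divide)
  qed
  moreover have "4 * n / (1 + n)\<^sup>2 + 4 / (1 + n)\<^sup>2 = 4 / (1 + n)"
  proof -
    have "4 * n / (1 + n)\<^sup>2 + 4 / (1 + n)\<^sup>2 = (4 * (1 + n)) / ((1 + n) * (1 + n))"
      by (simp add: power2_eq_square add_divide_distrib[symmetric])
    then show ?thesis by (simp only: nonzero_mult_divide_mult_cancel_right[OF n])
  qed
  ultimately show ?thesis using n0
    by (simp add: stereo_def dist_norm norm_Pair n_def[symmetric] norm_mult power_divide power_mult_distrib)
qed

lemma stereo_in_sphere: "stereo z \<in> sphere 0 1"
proof -
  define n where "n = (norm z)\<^sup>2"
  have n: "1 + n \<noteq> 0" "n + 1 \<noteq> 0" by (simp_all add: n_def add_nonneg_eq_0_iff)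
  have "(norm ((2 / (1 + n)) *\<^sub>R z))\<^sup>2 = 4 * n / (1 + n)\<^sup>2"
    by (simp add: power_divide power_mult_distrib n_def)
  moreover have "(norm ((n - 1) / (n + 1)))\<^sup>2 = (n - 1)\<^sup>2 / (1 + n)\<^sup>2"
    by (simp add: power_divide add.commute)
  moreover have "4 * n / (1 + n)\<^sup>2 + (n - 1)\<^sup>2 / (1 + n)\<^sup>2 = 1"
    using n by (simp add: add_divide_distrib[symmetric]) (simp add: power2_eq_square algebra_simps)
  ultimately have "norm (stereo z) = 1"
    by (simp add: stereo_def norm_Pair n_def[symmetric] del: norm_scaleR)
  then show ?thesis by simp
qed

lemma inj_stereo: "inj stereo"
proof (rule injI)
  fix z w assume eq: "stereo z = stereo w"
  then have "4 / (1 + (norm z)\<^sup>2) = 4 / (1 + (norm w)\<^sup>2)"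
    using dist_stereo_infinity by metis
  moreover have "1 + (norm z)\<^sup>2 \<noteq> 0" "1 + (norm w)\<^sup>2 \<noteq> 0" by (simp_all add: add_nonneg_eq_0_iff)
  ultimately have n: "(norm z)\<^sup>2 = (norm w)\<^sup>2" by (simp add: frac_eq_eq)
  have "2 / (1 + (norm w)\<^sup>2) \<noteq> 0" by (simp add: add_nonneg_eq_0_iff)
  then show "z = w" using eq unfolding stereo_def n by simp
qed

lemma continuous_on_stereo: "continuous_on S stereo"
proof -
  have "1 + (norm z)\<^sup>2 \<noteq> 0" "(norm z)\<^sup>2 + 1 \<noteq> 0" for z :: complex by (simp_all add: add_nonneg_eq_0_iff)
  then show ?thesis unfolding stereo_def by (intro continuous_intros) auto
qed

text \<open>A sequence of iterates either repeats some iterate infinitely often, and then has a constant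
subsequence, or its exponents tend to infinity, and then it converges to infinity uniformly on
\<open>U\<close> by the geometric escape rate.\<close>

lemma normal_family_on_iterates_escaping:
  assumes c: "0 < c"
    and escape: "\<And>n z. z \<in> U \<Longrightarrow> c * 2 ^ n \<le> norm ((f ^^ (n0 + n)) z)"
  shows "normal_family_on U (range (\<lambda>n. f ^^ n))"
  unfolding normal_family_on_def
proof (intro allI impI)
  fix h :: "nat \<Rightarrow> complex \<Rightarrow> complex" assume "range h \<subseteq> range (\<lambda>n. f ^^ n)"
  then have "\<forall>i. \<exists>n. h i = f ^^ n" by (auto simp: image_subset_iff image_iff)
  then obtain e where e: "\<And>i. h i = f ^^ e i" by metis
  show "\<exists>r g. strict_mono r \<and> g \<in> U \<rightarrow> sphere 0 1 \<and>
      (\<forall>C. compact C \<and> C \<subseteq> U \<longrightarrow> uniform_limit C (\<lambda>n z. stereo (h (r n) z)) g sequentially)"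
  proof (cases "\<exists>n. infinite {i. e i = n}")
    case True
    then obtain n where inf: "infinite {i. e i = n}" by blast
    define r where "r = enumerate {i. e i = n}"
    have r: "strict_mono r" unfolding r_def by (rule strict_mono_enumerate[OF inf])
    have "e (r j) = n" for j using enumerate_in_set[OF inf, of j] by (simp add: r_def)
    then have "uniform_limit C (\<lambda>j z. stereo (h (r j) z)) (\<lambda>z. stereo ((f ^^ n) z)) sequentially" for C
      by (simp add: e uniform_limit_const)
    then show ?thesis using r stereo_in_sphere
      by (intro exI[of _ r] exI[of _ "\<lambda>z. stereo ((f ^^ n) z)"]) auto
  next
    case False
    have e_lim: "filterlim e at_top sequentially"
      unfolding filterlim_at_top
    proof
      fix b
      have "{i. e i < b} = (\<Union>n<b. {i. e i = n})" by auto
      then have "finite {i. e i < b}" using False by simp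
      then have "\<forall>\<^sub>F i in cofinite. b \<le> e i" by (simp add: eventually_cofinite not_le)
      then show "\<forall>\<^sub>F i in sequentially. b \<le> e i" by (simp add: cofinite_eq_sequentially)
    qed
    have "uniform_limit C (\<lambda>i z. stereo (h i z)) (\<lambda>z. (0, 1)) sequentially" if C: "C \<subseteq> U" for C
    proof (rule uniform_limitI)
      fix \<epsilon> :: real assume \<epsilon>: "0 < \<epsilon>"
      obtain b :: nat where b: "2 / (c * \<epsilon>) < 2 ^ b" using real_arch_pow[of 2] by force
      have "\<forall>\<^sub>F i in sequentially. n0 + b \<le> e i" using e_lim unfolding filterlim_at_top by blast
      then show "\<forall>\<^sub>F i in sequentially. \<forall>z\<in>C. dist (stereo (h i z)) (0, 1) < \<epsilon>"
      proof eventually_elim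
        case (elim i)
        show ?case
        proof
          fix z assume z: "z \<in> C"
          let ?w = "(f ^^ e i) z"
          have "2 / \<epsilon> < c * 2 ^ b" using b c \<epsilon> by (simp add: field_simps)
          also have "\<dots> \<le> c * 2 ^ (e i - n0)" using elim c by (intro mult_left_mono power_increasing) auto
          also have "\<dots> \<le> norm ?w" using escape[of z "e i - n0"] z C elim by auto
          finally have "2 < norm ?w * \<epsilon>" using \<epsilon> by (simp add: field_simps)
          then have "2\<^sup>2 < (norm ?w * \<epsilon>)\<^sup>2" by (intro power_strict_mono) auto
          then have "4 < (norm ?w)\<^sup>2 * \<epsilon>\<^sup>2" by (simp add: power_mult_distrib)
          moreover have "0 < \<epsilon>\<^sup>2" using \<epsilon> by simp
          ultimately have "4 < (1 + (norm ?w)\<^sup>2) * \<epsilon>\<^sup>2"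
            unfolding distrib_right by linarith
          moreover have "1 + (norm ?w)\<^sup>2 > 0" by (simp add: add_pos_nonneg)
          ultimately have "(dist (stereo ?w) (0, 1))\<^sup>2 < \<epsilon>\<^sup>2"
            unfolding dist_stereo_infinity by (simp add: divide_less_eq mult.commute)
          then show "dist (stereo (h i z)) (0, 1) < \<epsilon>" unfolding e using \<epsilon> by (intro power2_less_imp_less[of _ \<epsilon>]) auto
        qed
      qed
    qed
    then show ?thesis by (intro exI[of _ id] exI[of _ "\<lambda>z. (0, 1)"]) (auto simp: norm_Pair strict_mono_def)
  qed
qed

section \<open>Dynamics of the extension\<close>

lemma LIMSEQ_geometric_bound:
  fixes s c :: real
  assumes "0 < s" "s < 1" "\<And>n. dist (y n) z \<le> c * s ^ n"
  shows "y \<longlonglongrightarrow> z"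
proof -
  have "(\<lambda>n. c * s ^ n) \<longlonglongrightarrow> 0"
    using tendsto_mult_left[OF LIMSEQ_power_zero, of s c] assms by simp
  then have "(\<lambda>n. dist (y n) z) \<longlonglongrightarrow> 0"
    by (rule Lim_null_comparison[rotated]) (use assms(3) in simp)
  then show ?thesis by (rule tendsto_dist_iff[THEN iffD2])
qed

text \<open>What the dynamical argument uses of the constructed map.  The complement of the disk of radius
\<open>r\<close> is forward invariant, expanding and free of distortion, and a point where \<open>F\<close> is not
conformal is sent there at once.\<close>

locale ifs_extension =
  fixes m :: nat and \<phi> :: "nat \<Rightarrow> complex \<Rightarrow> complex" and F :: "complex \<Rightarrow> complex" and r k :: real
  assumes ifs: "conformal_disk_ifs m \<phi>"
    and r: "0 < r" "r < 1" and k: "0 \<le> k" "k < 1"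
    and images: "\<And>i. i \<in> {1..m} \<Longrightarrow> \<phi> i ` cball 0 1 \<subseteq> ball 0 r"
    and C1: "C1_on UNIV F"
    and inverse: "\<And>i z. i \<in> {1..m} \<Longrightarrow> norm z \<le> r \<Longrightarrow> F (\<phi> i z) = z"
    and preimage: "\<And>z. norm (F z) \<le> r \<Longrightarrow> \<exists>i\<in>{1..m}. z \<in> \<phi> i ` cball 0 r"
    and expand: "\<And>z. r \<le> norm z \<Longrightarrow> 2 * norm z \<le> norm (F z)"
    and conformal_outside: "\<And>z. r \<le> norm z \<Longrightarrow> qc_at 0 F z"
    and qc: "\<And>z. qc_at k F z"
    and conformal_or_outside: "\<And>z. qc_at 0 F z \<or> r \<le> norm (F z)"
begin

text \<open>This is the filled Julia set of \<open>F\<close>; it coincides with the attractor.\<close>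
definition trapped :: "complex set" where
  "trapped = {z. \<forall>n. norm ((F ^^ n) z) \<le> r}"

lemma escape: "r \<le> norm z \<Longrightarrow> r * 2 ^ n \<le> norm ((F ^^ n) z)"
proof (induction n)
  case (Suc n)
  have "r * 1 \<le> r * 2 ^ n" using r by (intro mult_left_mono) auto
  then show ?case using Suc expand[of "(F ^^ n) z"] by simp
qed simp

lemma escape_ge: "r \<le> norm z \<Longrightarrow> r \<le> norm ((F ^^ n) z)"
proof -
  assume z: "r \<le> norm z"
  have "r * 1 \<le> r * 2 ^ n" using r by (intro mult_left_mono) auto
  then show ?thesis using escape[OF z, of n] by simp
qed

lemma iterate_conformal_outside: "r \<le> norm z \<Longrightarrow> qc_at 0 (F ^^ n) z"
proof (induction n)
  case 0
  show ?case by (simp add: id_def qc_at_field_derivative[OF DERIV_ident])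
next
  case (Suc n)
  then show ?case
    unfolding funpow.simps using escape_ge by (intro qc_at_compose_conformal conformal_outside) auto
qed

text \<open>An orbit meets the region where \<open>F\<close> is not conformal at most once: before that moment all
factors of the chain rule are conformal, and afterwards the orbit stays outside the disk of radius
\<open>r\<close>.  Hence the dilatation of an iterate is at most that of \<open>F\<close> itself.\<close>

lemma iterate_qc: "qc_at k (F ^^ n) z"
proof (induction n arbitrary: z)
  case 0
  show ?case using qc_at_mono[OF qc_at_field_derivative[OF DERIV_ident] k(1)] by (simp add: id_def)
next
  case (Suc n)
  show ?case unfolding funpow_Suc_right
  proof (cases "qc_at 0 F z")
    case True
    then show "qc_at k (F ^^ n \<circ> F) z" by (rule qc_at_compose_conformal[OF _ Suc])
  next
    case False
    then have "r \<le> norm (F z)" using conformal_or_outside by blast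
    then show "qc_at k (F ^^ n \<circ> F) z"
      by (intro qc_at_conformal_compose qc iterate_conformal_outside)
  qed
qed

lemma uniformly_quasiregular_extension: "uniformly_quasiregular F"
  unfolding uniformly_quasiregular_def
  using quasiregular_C1[OF C1_on_funpow[OF C1] iterate_qc k] by blast

lemma lipschitz:
  obtains s where "0 < s" "s < 1"
    "\<And>i x y. i \<in> {1..m} \<Longrightarrow> norm x \<le> 1 \<Longrightarrow> norm y \<le> 1 \<Longrightarrow> dist (\<phi> i x) (\<phi> i y) \<le> s * dist x y"
proof -
  have "\<forall>i\<in>{1..m}. \<exists>s. s \<in> {0<..<1} \<and> s-lipschitz_on (cball 0 1) (\<phi> i)" and m: "1 \<le> m"
    using ifs unfolding conformal_disk_ifs_def ifs_def by blast+
  then obtain s where s: "\<And>i. i \<in> {1..m} \<Longrightarrow> s i \<in> {0<..<1} \<and> (s i)-lipschitz_on (cball 0 1) (\<phi> i)"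
    using bchoice by metis
  define S where "S = Max (s ` {1..m})"
  have ne: "finite (s ` {1..m})" "s ` {1..m} \<noteq> {}" using m by auto
  have le: "s i \<le> S" if "i \<in> {1..m}" for i using that by (simp add: S_def)
  have "S \<in> s ` {1..m}" unfolding S_def by (rule Max_in[OF ne])
  then have "0 < S" "S < 1" using s by auto
  then show thesis
  proof (rule that)
    fix i x y assume i: "i \<in> {1..m}" and xy: "norm (x::complex) \<le> 1" "norm (y::complex) \<le> 1"
    have "dist (\<phi> i x) (\<phi> i y) \<le> s i * dist x y"
      using s[OF i] xy by (intro lipschitz_onD[of "s i" "cball 0 1"]) auto
    also have "\<dots> \<le> S * dist x y" using le[OF i] by (intro mult_right_mono) auto
    finally show "dist (\<phi> i x) (\<phi> i y) \<le> S * dist x y" .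
  qed
qed

lemma trapped_bound: "z \<in> trapped \<Longrightarrow> norm z \<le> r"
  unfolding trapped_def by (auto dest: spec[of _ 0])

lemma trapped_forward: "z \<in> trapped \<Longrightarrow> F z \<in> trapped"
proof -
  assume z: "z \<in> trapped"
  have "norm ((F ^^ n) (F z)) \<le> r" for n
  proof -
    have "norm ((F ^^ Suc n) z) \<le> r" using z unfolding trapped_def by blast
    then show ?thesis unfolding funpow_Suc_right by simp
  qed
  then show ?thesis by (simp add: trapped_def)
qed

lemma trapped_preimage:
  assumes "z \<in> trapped" obtains i where "i \<in> {1..m}" "z = \<phi> i (F z)"
proof -
  obtain i y where i: "i \<in> {1..m}" and y: "norm y \<le> r" "z = \<phi> i y"
    using preimage[of z] trapped_bound[OF trapped_forward[OF assms]] by auto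
  then have "F z = y" using inverse by simp
  then show thesis using that[OF i] y by simp
qed

lemma trapped_image: "i \<in> {1..m} \<Longrightarrow> y \<in> trapped \<Longrightarrow> \<phi> i y \<in> trapped"
proof -
  assume i: "i \<in> {1..m}" and y: "y \<in> trapped"
  have "\<phi> i y \<in> \<phi> i ` cball 0 1" using trapped_bound[OF y] r by (intro imageI) simp
  then have "\<phi> i y \<in> ball 0 r" using images[OF i] by blast
  moreover have "F (\<phi> i y) = y" using inverse[OF i] trapped_bound[OF y] by simp
  ultimately have "norm ((F ^^ n) (\<phi> i y)) \<le> r" for n
    using y by (cases n) (simp_all add: trapped_def funpow_Suc_right del: funpow.simps(2))
  then show ?thesis by (simp add: trapped_def)
qed

lemma trapped_self_similar: "trapped = (\<Union>i\<in>{1..m}. \<phi> i ` trapped)"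
proof (intro equalityI subsetI)
  fix z assume z: "z \<in> trapped"
  then obtain i where "i \<in> {1..m}" "z = \<phi> i (F z)" by (rule trapped_preimage)
  with trapped_forward[OF z] show "z \<in> (\<Union>i\<in>{1..m}. \<phi> i ` trapped)" by blast
next
  fix z assume "z \<in> (\<Union>i\<in>{1..m}. \<phi> i ` trapped)"
  then obtain i y where "i \<in> {1..m}" "y \<in> trapped" "z = \<phi> i y" by blast
  then show "z \<in> trapped" using trapped_image by simp
qed

lemma compact_trapped: "compact trapped"
proof -
  have "continuous_on UNIV (F ^^ n)" for n by (rule C1_on_imp_continuous_on[OF C1_on_funpow[OF C1]])
  then have "closed {z. norm ((F ^^ n) z) \<le> r}" for n
    by (intro closed_Collect_le continuous_intros) auto
  then have "closed (\<Inter>n. {z. norm ((F ^^ n) z) \<le> r})" by blast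
  moreover have "trapped = (\<Inter>n. {z. norm ((F ^^ n) z) \<le> r})" by (auto simp: trapped_def)
  moreover have "bounded trapped" using trapped_bound bounded_iff by blast
  ultimately show ?thesis by (simp add: compact_eq_bounded_closed)
qed

lemma trapped_nonempty: "trapped \<noteq> {}"
proof -
  have m: "1 \<in> {1..m}" using ifs by (simp add: conformal_disk_ifs_def ifs_def)
  obtain s where s: "0 < s" "s < 1"
    "\<And>i x y. i \<in> {1..m} \<Longrightarrow> norm x \<le> 1 \<Longrightarrow> norm y \<le> 1 \<Longrightarrow> dist (\<phi> i x) (\<phi> i y) \<le> s * dist x y"
    using lipschitz by blast
  have "\<exists>!x\<in>cball 0 1. \<phi> 1 x = x"
  proof (rule Banach_fix)
    have "ball 0 r \<subseteq> cball (0::complex) 1" using r by auto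
    then show "\<phi> 1 ` cball 0 1 \<subseteq> cball 0 1" using images[OF m] by blast
    show "dist (\<phi> 1 x) (\<phi> 1 y) \<le> s * dist x y" if "x \<in> cball 0 1" "y \<in> cball 0 1" for x y
      using s(3)[OF m] that by simp
  qed (use s in \<open>auto intro: compact_imp_complete\<close>)
  then obtain x where x: "norm x \<le> 1" "\<phi> 1 x = x" by auto
  have xr: "norm x \<le> r" using images[OF m] x by force
  have "(F ^^ n) x = x" for n using inverse[OF m xr] x by (induction n) auto
  then have "x \<in> trapped" using xr by (simp add: trapped_def)
  then show ?thesis by blast
qed

text \<open>Following the orbit of \<open>z\<close> backwards along the contractions that produce it pulls any point
\<open>x\<close> back to within \<open>2 s\<^sup>n\<close> of \<open>z\<close>; the factor 2 bounds the diameter of the unit disk.\<close>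

lemma shrinking_preimages:
  assumes s: "0 < s" "s < 1"
    "\<And>i x y. i \<in> {1..m} \<Longrightarrow> norm x \<le> 1 \<Longrightarrow> norm y \<le> 1 \<Longrightarrow> dist (\<phi> i x) (\<phi> i y) \<le> s * dist x y"
    and S: "x \<in> S" "S \<subseteq> cball 0 r" "\<And>i. i \<in> {1..m} \<Longrightarrow> \<phi> i ` S \<subseteq> S"
    and z: "z \<in> trapped"
  shows "\<exists>y\<in>S. (F ^^ n) y = x \<and> dist y z \<le> 2 * s ^ n"
  using z
proof (induction n arbitrary: z)
  case 0
  have "dist x z \<le> norm x + norm z" by (metis dist_norm norm_triangle_ineq4)
  then show ?case using S trapped_bound[OF 0] r by (intro bexI[of _ x]) auto
next
  case (Suc n)
  obtain y where y: "y \<in> S" "(F ^^ n) y = x" "dist y (F z) \<le> 2 * s ^ n"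
    using Suc.IH[OF trapped_forward[OF Suc.prems]] by blast
  obtain i where i: "i \<in> {1..m}" "z = \<phi> i (F z)" using trapped_preimage[OF Suc.prems] by blast
  have yr: "norm y \<le> r" using y S by auto
  have "dist (\<phi> i y) (\<phi> i (F z)) \<le> s * dist y (F z)"
    using s(3)[OF i(1)] yr trapped_bound[OF trapped_forward[OF Suc.prems]] r by auto
  also have "\<dots> \<le> s * (2 * s ^ n)" using y s by (intro mult_left_mono) auto
  finally have "dist (\<phi> i y) z \<le> 2 * s ^ Suc n" using i(2) by simp
  moreover have "(F ^^ Suc n) (\<phi> i y) = x"
    using inverse[OF i(1) yr] y by (simp add: funpow_Suc_right del: funpow.simps(2))
  ultimately show ?case using S(3)[OF i(1)] y(1) by blast
qed

text \<open>An invariant set \<open>S\<close> lies in the images of the \<open>\<phi>\<^sub>i\<close>, where \<open>F\<close> inverts them, so \<open>F\<close>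
maps \<open>S\<close> to itself and all its orbits are trapped.  Conversely preimages in \<open>S\<close> of a point of \<open>S\<close>
accumulate at every trapped point.\<close>

lemma attractor_eq_trapped: "attractor (cball 0 1) m \<phi> = trapped"
  unfolding attractor_def
proof (rule the_equality)
  show "trapped \<noteq> {} \<and> compact trapped \<and> trapped \<subseteq> cball 0 1 \<and> trapped = (\<Union>i\<in>{1..m}. \<phi> i ` trapped)"
  proof (intro conjI trapped_nonempty compact_trapped trapped_self_similar)
    show "trapped \<subseteq> cball 0 1" using trapped_bound r by force
  qed
next
  fix S assume S: "S \<noteq> {} \<and> compact S \<and> S \<subseteq> cball 0 1 \<and> S = (\<Union>i\<in>{1..m}. \<phi> i ` S)"
  then have eq: "S = (\<Union>i\<in>{1..m}. \<phi> i ` S)" and ne: "S \<noteq> {}" by blast+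
  have "\<phi> i ` S \<subseteq> ball 0 r" if "i \<in> {1..m}" for i using images[OF that] S by blast
  then have Sr: "S \<subseteq> cball 0 r" using eq by force
  have F_S: "F z \<in> S" if "z \<in> S" for z
  proof -
    obtain i y where "i \<in> {1..m}" "y \<in> S" "z = \<phi> i y" using eq \<open>z \<in> S\<close> by blast
    then show ?thesis using inverse[of i y] Sr by auto
  qed
  have "(F ^^ n) z \<in> S" if "z \<in> S" for n z using that by (induction n) (auto intro: F_S)
  then have "S \<subseteq> trapped" using Sr by (force simp: trapped_def)
  moreover have "trapped \<subseteq> S"
  proof
    fix z assume z: "z \<in> trapped"
    obtain s where s: "0 < s" "s < 1"
      "\<And>i x y. i \<in> {1..m} \<Longrightarrow> norm x \<le> 1 \<Longrightarrow> norm y \<le> 1 \<Longrightarrow> dist (\<phi> i x) (\<phi> i y) \<le> s * dist x y"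
      using lipschitz by blast
    obtain x where x: "x \<in> S" using ne by blast
    have "\<exists>y. y \<in> S \<and> dist y z \<le> 2 * s ^ n" for n
      using shrinking_preimages[OF s x Sr _ z, of n] eq by blast
    then obtain y where y: "\<And>n. y n \<in> S" "\<And>n. dist (y n) z \<le> 2 * s ^ n" by metis
    have "y \<longlonglongrightarrow> z" by (rule LIMSEQ_geometric_bound[OF s(1,2) y(2)])
    moreover have "closed S" using S compact_imp_closed by blast
    ultimately show "z \<in> S" using y(1) closed_sequentially by blast
  qed
  ultimately show "S = trapped" by blast
qed

lemma julia_subset_trapped: "julia_set F \<subseteq> trapped"
proof
  fix z assume z: "z \<in> julia_set F"
  show "z \<in> trapped"
  proof (rule ccontr)
    assume "z \<notin> trapped"
    then obtain n where n: "r < norm ((F ^^ n) z)" by (auto simp: trapped_def not_le)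
    define U where "U = {w. r < norm ((F ^^ n) w)}"
    have cont: "continuous_on UNIV (F ^^ n)" by (rule C1_on_imp_continuous_on[OF C1_on_funpow[OF C1]])
    have "open U" unfolding U_def by (intro open_Collect_less continuous_intros cont)
    moreover have "normal_family_on U (range (\<lambda>n. F ^^ n))"
    proof (rule normal_family_on_iterates_escaping[OF r(1), of _ n])
      fix j w assume "w \<in> U"
      then have "r * 2 ^ j \<le> norm ((F ^^ j) ((F ^^ n) w))" by (intro escape) (simp add: U_def)
      then show "r * 2 ^ j \<le> norm ((F ^^ (n + j)) w)" by (simp add: add.commute[of n] funpow_add)
    qed
    moreover have "z \<in> U" using n by (simp add: U_def)
    ultimately show False using z unfolding julia_set_def by blast
  qed
qed

text \<open>Arbitrarily close to a trapped point \<open>z\<close> there are points that \<open>F\<^sup>n\<close> sends to one fixed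
point \<open>x\<close> outside the compact trapped set, whereas the orbit of \<open>z\<close> stays in that set.  A
continuous limit of iterates would have to take both kinds of values at \<open>z\<close>.\<close>

lemma trapped_subset_julia: "trapped \<subseteq> julia_set F"
proof
  fix z assume z: "z \<in> trapped"
  obtain s where s: "0 < s" "s < 1"
    "\<And>i x y. i \<in> {1..m} \<Longrightarrow> norm x \<le> 1 \<Longrightarrow> norm y \<le> 1 \<Longrightarrow> dist (\<phi> i x) (\<phi> i y) \<le> s * dist x y"
    using lipschitz by blast
  \<comment> \<open>A point of norm exactly \<open>r\<close> is still inverted by \<open>F\<close>, but the trapped set lies in the images
    of the contractions, hence in the open disk of radius \<open>r\<close>.\<close>
  define x where "x = complex_of_real r"
  have x: "norm x = r" using r by (simp add: x_def)
  have "\<phi> i ` cball 0 r \<subseteq> cball 0 r" if "i \<in> {1..m}" for i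
  proof -
    have "\<phi> i ` cball 0 r \<subseteq> \<phi> i ` cball 0 1" using r by (intro image_mono) auto
    then show ?thesis using images[OF that] ball_subset_cball by blast
  qed
  then have "\<exists>y. (F ^^ n) y = x \<and> dist y z \<le> 2 * s ^ n" for n
    using shrinking_preimages[OF s, of x "cball 0 r" z n] x z by auto
  then obtain y where y: "\<And>n. (F ^^ n) (y n) = x" "\<And>n. dist (y n) z \<le> 2 * s ^ n" by metis
  have y_lim: "y \<longlonglongrightarrow> z" by (rule LIMSEQ_geometric_bound[OF s(1,2) y(2)])
  have "x \<notin> trapped"
  proof
    assume "x \<in> trapped"
    then obtain i where "i \<in> {1..m}" "x = \<phi> i (F x)" by (rule trapped_preimage)
    then have "norm x < r"
      using images[of i] trapped_bound[OF trapped_forward[OF \<open>x \<in> trapped\<close>]] r by force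
    then show False using x by simp
  qed
  then have x_notin: "stereo x \<notin> stereo ` trapped" using inj_stereo by (auto dest: injD)
  show "z \<in> julia_set F"
    unfolding julia_set_def
  proof (clarify)
    fix U assume U: "open U" "z \<in> U" and normal: "normal_family_on U (range (\<lambda>n. F ^^ n))"
    obtain t g where t: "strict_mono t"
      and lim: "\<And>C. compact C \<Longrightarrow> C \<subseteq> U \<Longrightarrow> uniform_limit C (\<lambda>n w. stereo ((F ^^ t n) w)) g sequentially"
      using normal[unfolded normal_family_on_def, rule_format, of "\<lambda>n. F ^^ n"] by blast
    obtain d where d: "d > 0" "cball z d \<subseteq> U" using U open_contains_cball by blast
    have ul: "uniform_limit (cball z d) (\<lambda>n w. stereo ((F ^^ t n) w)) g sequentially"
      using lim d(2) by simp
    have "continuous_on (cball z d) (\<lambda>w. stereo ((F ^^ t n) w))" for n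
      using C1_on_imp_continuous_on[OF C1_on_funpow[OF C1]] continuous_on_stereo
      by (auto intro: continuous_on_compose2 continuous_on_subset)
    then have g: "continuous_on (cball z d) g"
      using uniform_limit_theorem[OF _ ul] by simp
    have yt: "(y \<circ> t) \<longlonglongrightarrow> z" by (rule LIMSEQ_subseq_LIMSEQ[OF y_lim t])
    have "(\<lambda>n. dist ((y \<circ> t) n) z) \<longlonglongrightarrow> 0" using yt by (rule tendsto_dist_iff[THEN iffD1])
    then have "\<forall>\<^sub>F n in sequentially. dist ((y \<circ> t) n) z < d" using d(1) by (rule order_tendstoD)
    then have ev: "\<forall>\<^sub>F n in sequentially. (y \<circ> t) n \<in> cball z d"
      by eventually_elim (simp add: dist_commute)
    have g_lim: "(\<lambda>n. g ((y \<circ> t) n)) \<longlonglongrightarrow> g z"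
      using continuous_on_tendsto_compose[OF g yt _ ev] d(1) by simp
    have "(\<lambda>n. dist (stereo x) (g ((y \<circ> t) n))) \<longlonglongrightarrow> 0"
    proof (rule tendstoI)
      fix e :: real assume "0 < e"
      from uniform_limitD[OF ul this] ev
      show "\<forall>\<^sub>F n in sequentially. dist (dist (stereo x) (g ((y \<circ> t) n))) 0 < e"
      proof eventually_elim
        case (elim n)
        have "dist (stereo ((F ^^ t n) ((y \<circ> t) n))) (g ((y \<circ> t) n)) < e" using elim by blast
        then show ?case by (simp add: y(1))
      qed
    qed
    moreover have "(\<lambda>n. dist (stereo x) (g ((y \<circ> t) n))) \<longlonglongrightarrow> dist (stereo x) (g z)"
      using g_lim by (intro tendsto_intros)
    ultimately have "dist (stereo x) (g z) = 0" by (rule LIMSEQ_unique[symmetric])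
    then have gx: "g z = stereo x" by simp
    have "(\<lambda>n. stereo ((F ^^ t n) z)) \<longlonglongrightarrow> g z"
      using tendsto_uniform_limitI[OF ul] d(1) by simp
    moreover have "(F ^^ n) z \<in> trapped" for n
      using z by (induction n) (auto intro: trapped_forward)
    moreover have "closed (stereo ` trapped)"
      using compact_trapped continuous_on_stereo by (intro compact_imp_closed compact_continuous_image)
    ultimately have "g z \<in> stereo ` trapped"
      using closed_sequentially[of "stereo ` trapped" "\<lambda>n. stereo ((F ^^ t n) z)" "g z"] by blast
    then show False using gx x_notin by simp
  qed
qed

end

theorem theorem1p3:
  fixes m :: nat and \<phi> :: "nat \<Rightarrow> complex \<Rightarrow> complex"
  assumes "conformal_disk_ifs m \<phi>"
    and "strong_disk_open_set_condition m \<phi>"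
  shows "\<exists>f :: complex \<Rightarrow> complex.
           uniformly_quasiregular f \<and> julia_set f = attractor (cball 0 1) m \<phi>"
proof -
  obtain F r k where "ifs_extension m \<phi> F r k"
  proof (rule expanding_extension[OF assms])
    fix r k F
    assume "0 < r" "r < 1" "0 \<le> k" "k < 1"
      "\<And>i. i \<in> {1..m} \<Longrightarrow> \<phi> i ` cball 0 1 \<subseteq> ball 0 r"
      "C1_on UNIV F"
      "\<And>i z. i \<in> {1..m} \<Longrightarrow> norm z \<le> r \<Longrightarrow> F (\<phi> i z) = z"
      "\<And>z. norm (F z) \<le> r \<Longrightarrow> \<exists>i\<in>{1..m}. z \<in> \<phi> i ` cball 0 r"
      "\<And>z. r \<le> norm z \<Longrightarrow> 2 * norm z \<le> norm (F z)"
      "\<And>z. r \<le> norm z \<Longrightarrow> qc_at 0 F z"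
      "\<And>z. qc_at k F z"
      "\<And>z. qc_at 0 F z \<or> r \<le> norm (F z)"
    then have "ifs_extension m \<phi> F r k" using assms(1) by unfold_locales
    then show ?thesis by (rule that)
  qed
  then interpret ifs_extension m \<phi> F r k .
  show ?thesis
    using uniformly_quasiregular_extension julia_subset_trapped trapped_subset_julia attractor_eq_trapped
    by blast
qed

end
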